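(* The class of Douglas metrics is a proper subset of the class of generalized $\tilde D$-metrics. That is, every Douglas metric is a generalized $\tilde D$-metric, and there exists a Finsler metric (on some manifold) that is a generalized $\tilde D$-metric but not a Douglas metric.
   Context: Let $M$ be an $n$-dimensional smooth manifold. A Finsler metric on $M$ is a non-negative function $F$ on $TM$ that is $C^\infty$ on $TM_0=TM\setminus\{0\}$, positively homogeneous of degree one in $y$, and such that $g_{ij}=\frac12\frac{\partial^2F^2}{\partial y^i\partial y^j}$ is positive definite at every $y\neq 0$. Its spray coefficients are $G^i(x,y)=\frac14 g^{il}\left\{\frac{\partial^2F^2}{\partial x^k\partial y^l}y^k-\frac{\partial F^2}{\partial x^l}\right\}$. Notation: "$._k$" denotes $\partial/\partial y^k$; "$|_m$" denotes the horizontal covariant derivative with respect to the Berwald connection of $F$, e.g. $T^i{}_{j|m}=\frac{\partial T^i{}_j}{\partial x^m}-G^r{}_{.m}T^i{}_{j.r}+T^r{}_jG^i{}_{.r.m}-T^i{}_rG^r{}_{.j.m}$, and similarly for other tensors on $TM_0$. A subscript $0$ denotes contraction with $y$: $T_{|0}=T_{|m}y^m$. The Douglas tensor is $D_j{}^i{}_{kl}=\frac{\partial^3}{\partial y^j\partial y^k\partial y^l}\left(G^i-\frac1{n+1}\frac{\partial G^m}{\partial y^m}y^i\right)$. $F$ is a Douglas metric if $D_j{}^i{}_{kl}=0$. Put $\tilde D_j{}^i{}_{kl}=D_j{}^i{}_{kl|0}$. $F$ is a generalized $\tilde D$-metric if $\tilde D_j{}^i{}_{kl|0}+\mu_r\tilde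 D_j{}^r{}_{kl}y^i=0$ for the coefficients $\mu_r$ of some tensor. *)

theory Defs
  imports "HOL-Analysis.Analysis"
begin

text \<open>
  The dimension of a manifold is a natural number that statements may quantify over, so Euclidean
  spaces are carved out of a function type by their index set: \<open>\<real>\<^sup>I\<close> is the set of functions
  vanishing off \<open>I\<close>, with the topology inherited from the product topology.  The index set is
  \<open>{..<n}\<close> for points and tangent vectors, and \<open>{..<n} <+> {..<n}\<close> for the coordinates on the
  tangent bundle: index \<open>Inl i\<close> is \<open>x\<^sup>i\<close>, index \<open>Inr i\<close> is \<open>y\<^sup>i\<close>.
\<close>

definition coord_space :: "'i set \<Rightarrow> ('i \<Rightarrow> real) set" where
  "coord_space I = {x. \<forall>i. i \<notin> I \<longrightarrow> x i = 0}"

definition pd :: "'i \<Rightarrow> (('i \<Rightarrow> real) \<Rightarrow> real) \<Rightarrow> ('i \<Rightarrow> real) \<Rightarrow> real" where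
  "pd i f x = deriv (\<lambda>t. f (x(i := t))) (x i)"

text \<open>Here \<open>W\<close> is meant to be a (relatively) open subset of \<open>coord_space I\<close> with \<open>I\<close> finite.\<close>

fun Ck_on :: "nat \<Rightarrow> 'i set \<Rightarrow> ('i \<Rightarrow> real) set \<Rightarrow> (('i \<Rightarrow> real) \<Rightarrow> real) \<Rightarrow> bool" where
  "Ck_on 0 I W f \<longleftrightarrow> continuous_on W f"
| "Ck_on (Suc k) I W f \<longleftrightarrow> continuous_on W f \<and>
     (\<forall>i\<in>I. (\<forall>x\<in>W. (\<lambda>t. f (x(i := t))) differentiable (at (x i))) \<and> Ck_on k I W (pd i f))"

definition smooth_fun_on :: "'i set \<Rightarrow> ('i \<Rightarrow> real) set \<Rightarrow> (('i \<Rightarrow> real) \<Rightarrow> real) \<Rightarrow> bool" where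
  "smooth_fun_on I W f \<longleftrightarrow> (\<forall>k. Ck_on k I W f)"


section \<open>Smooth manifolds and their tangent bundles\<close>

text \<open>A chart is a domain together with a coordinate map, whose values off the domain are
  irrelevant.\<close>

type_synonym 'm chart = "'m set \<times> ('m \<Rightarrow> nat \<Rightarrow> real)"

abbreviation chart_dom :: "'m chart \<Rightarrow> 'm set" where "chart_dom \<equiv> fst"
abbreviation chart_map :: "'m chart \<Rightarrow> 'm \<Rightarrow> nat \<Rightarrow> real" where "chart_map \<equiv> snd"

definition transition :: "'m chart \<Rightarrow> 'm chart \<Rightarrow> (nat \<Rightarrow> real) \<Rightarrow> nat \<Rightarrow> real" where
  "transition c c' x = chart_map c' (inv_into (chart_dom c) (chart_map c) x)"

definition smooth_manifold :: "nat \<Rightarrow> 'm topology \<Rightarrow> 'm chart set \<Rightarrow> bool" where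
  "smooth_manifold n X A \<longleftrightarrow>
     Hausdorff_space X \<and> second_countable X \<and> (\<Union>c\<in>A. chart_dom c) = topspace X \<and>
     (\<forall>c\<in>A. openin X (chart_dom c) \<and>
        openin (top_of_set (coord_space {..<n})) (chart_map c ` chart_dom c) \<and>
        homeomorphic_map (subtopology X (chart_dom c))
          (top_of_set (chart_map c ` chart_dom c)) (chart_map c)) \<and>
     (\<forall>c\<in>A. \<forall>c'\<in>A. \<forall>i<n.
        smooth_fun_on {..<n} (chart_map c ` (chart_dom c \<inter> chart_dom c'))
          (\<lambda>x. transition c c' x i))"

text \<open>\<open>jacobian c c' p i j\<close> is the derivative of the \<open>i\<close>-th coordinate of \<open>c'\<close> with respect to the
  \<open>j\<close>-th coordinate of \<open>c\<close>, at the point \<open>p\<close>.\<close>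

definition jacobian :: "'m chart \<Rightarrow> 'm chart \<Rightarrow> 'm \<Rightarrow> nat \<Rightarrow> nat \<Rightarrow> real" where
  "jacobian c c' p i j = pd j (\<lambda>x. transition c c' x i) (chart_map c p)"

text \<open>A tangent vector at \<open>p\<close> is given by its components in all charts around \<open>p\<close>, related by the
  vector transformation law; the components in other charts are set to \<open>0\<close> to make the
  representation unique.\<close>

type_synonym 'm tangent = "'m \<times> ('m chart \<Rightarrow> nat \<Rightarrow> real)"

definition tangent_bundle :: "nat \<Rightarrow> 'm chart set \<Rightarrow> 'm tangent set" where
  "tangent_bundle n A = {(p, v).
     p \<in> (\<Union>c\<in>A. chart_dom c) \<and>
     (\<forall>c. c \<notin> A \<or> p \<notin> chart_dom c \<longrightarrow> v c = (\<lambda>_. 0)) \<and>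
     (\<forall>c\<in>A. p \<in> chart_dom c \<longrightarrow> v c \<in> coord_space {..<n}) \<and>
     (\<forall>c\<in>A. \<forall>c'\<in>A. p \<in> chart_dom c \<and> p \<in> chart_dom c' \<longrightarrow>
        (\<forall>i<n. v c' i = (\<Sum>j<n. jacobian c c' p i j * v c j)))}"

definition slit_tangent_bundle :: "nat \<Rightarrow> 'm chart set \<Rightarrow> 'm tangent set" where
  "slit_tangent_bundle n A = {(p, v) \<in> tangent_bundle n A. v \<noteq> (\<lambda>_ _. 0)}"

definition scale_tangent :: "real \<Rightarrow> 'm tangent \<Rightarrow> 'm tangent" where
  "scale_tangent a q = (fst q, \<lambda>c i. a * snd q c i)"

text \<open>Coordinates \<open>(x, y)\<close> of a tangent vector in the chart induced by \<open>c\<close> on the tangent bundle,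
  and the expression in these coordinates of a function on the tangent bundle.\<close>

definition tangent_coords :: "'m chart \<Rightarrow> 'm tangent \<Rightarrow> nat + nat \<Rightarrow> real" where
  "tangent_coords c q = case_sum (chart_map c (fst q)) (snd q c)"

definition local_rep :: "nat \<Rightarrow> 'm chart set \<Rightarrow> 'm chart \<Rightarrow> ('m tangent \<Rightarrow> real) \<Rightarrow>
    (nat + nat \<Rightarrow> real) \<Rightarrow> real" where
  "local_rep n A c f z =
     f (inv_into {q \<in> tangent_bundle n A. fst q \<in> chart_dom c} (tangent_coords c) z)"

text \<open>The coordinate domain of the part of \<open>TM\<^sub>0\<close> over \<open>c\<close>.\<close>

definition slit_dom :: "nat \<Rightarrow> 'm chart \<Rightarrow> (nat + nat \<Rightarrow> real) set" where
  "slit_dom n c = {case_sum x y | x y.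
     x \<in> chart_map c ` chart_dom c \<and> y \<in> coord_space {..<n} \<and> y \<noteq> (\<lambda>_. 0)}"

definition smooth_on_slit :: "nat \<Rightarrow> 'm chart set \<Rightarrow> ('m tangent \<Rightarrow> real) \<Rightarrow> 'm chart \<Rightarrow> bool" where
  "smooth_on_slit n A f c \<longleftrightarrow>
     smooth_fun_on ({..<n} <+> {..<n}) (slit_dom n c) (local_rep n A c f)"


section \<open>Local formulas\<close>

text \<open>In this section \<open>L\<close> is the coordinate expression of the Finsler metric \<open>F\<close> in some chart.\<close>

abbreviation pdx :: "nat \<Rightarrow> ((nat + nat \<Rightarrow> real) \<Rightarrow> real) \<Rightarrow> (nat + nat \<Rightarrow> real) \<Rightarrow> real" where
  "pdx i \<equiv> pd (Inl i)"

abbreviation pdy :: "nat \<Rightarrow> ((nat + nat \<Rightarrow> real) \<Rightarrow> real) \<Rightarrow> (nat + nat \<Rightarrow> real) \<Rightarrow> real" where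
  "pdy i \<equiv> pd (Inr i)"

definition fund_tensor :: "((nat + nat \<Rightarrow> real) \<Rightarrow> real) \<Rightarrow> nat \<Rightarrow> nat \<Rightarrow>
    (nat + nat \<Rightarrow> real) \<Rightarrow> real" where
  "fund_tensor L i j z = (1/2) * pdy i (pdy j (\<lambda>w. (L w)\<^sup>2)) z"

definition inverse_fund_tensor :: "nat \<Rightarrow> ((nat + nat \<Rightarrow> real) \<Rightarrow> real) \<Rightarrow>
    (nat + nat \<Rightarrow> real) \<Rightarrow> nat \<Rightarrow> nat \<Rightarrow> real" where
  "inverse_fund_tensor n L z = (THE h.
     (\<forall>i<n. \<forall>j<n. (\<Sum>l<n. h i l * fund_tensor L l j z) = (if i = j then 1 else 0)) \<and>
     (\<forall>i j. \<not> (i < n \<and> j < n) \<longrightarrow> h i j = 0))"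

definition spray :: "nat \<Rightarrow> ((nat + nat \<Rightarrow> real) \<Rightarrow> real) \<Rightarrow> nat \<Rightarrow>
    (nat + nat \<Rightarrow> real) \<Rightarrow> real" where
  "spray n L i z = (1/4) * (\<Sum>l<n. inverse_fund_tensor n L z i l *
     ((\<Sum>k<n. pdx k (pdy l (\<lambda>w. (L w)\<^sup>2)) z * z (Inr k)) - pdx l (\<lambda>w. (L w)\<^sup>2) z))"

text \<open>Tensors with one upper and three lower indices are written \<open>T j i k l\<close> for
  \<open>T\<^sub>j\<^sup>i\<^sub>k\<^sub>l\<close>, i.e. the second index is the upper one.\<close>

type_synonym tensor13 = "nat \<Rightarrow> nat \<Rightarrow> nat \<Rightarrow> nat \<Rightarrow> (nat + nat \<Rightarrow> real) \<Rightarrow> real"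

definition douglas_tensor :: "nat \<Rightarrow> ((nat + nat \<Rightarrow> real) \<Rightarrow> real) \<Rightarrow> tensor13" where
  "douglas_tensor n L j i k l = pdy j (pdy k (pdy l (\<lambda>w.
     spray n L i w - 1 / (real n + 1) * (\<Sum>m<n. pdy m (spray n L m) w) * w (Inr i))))"

text \<open>The horizontal covariant derivative \<open>T\<^sub>j\<^sup>i\<^sub>k\<^sub>l\<^sub>|\<^sub>m\<close> for the Berwald connection, with
  connection coefficients \<open>G\<^sup>i\<^sub>.\<^sub>r\<^sub>.\<^sub>m\<close>.\<close>

definition hcov :: "nat \<Rightarrow> ((nat + nat \<Rightarrow> real) \<Rightarrow> real) \<Rightarrow> tensor13 \<Rightarrow>
    nat \<Rightarrow> nat \<Rightarrow> nat \<Rightarrow> nat \<Rightarrow> nat \<Rightarrow> (nat + nat \<Rightarrow> real) \<Rightarrow> real" where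
  "hcov n L T j i k l m z =
     (let \<Gamma> = (\<lambda>i r. pdy m (pdy r (spray n L i)) z) in
      pdx m (T j i k l) z
      - (\<Sum>r<n. pdy m (spray n L r) z * pdy r (T j i k l) z)
      + (\<Sum>r<n. T j r k l z * \<Gamma> i r)
      - (\<Sum>r<n. T r i k l z * \<Gamma> r j)
      - (\<Sum>r<n. T j i r l z * \<Gamma> r k)
      - (\<Sum>r<n. T j i k r z * \<Gamma> r l))"

definition hcov0 :: "nat \<Rightarrow> ((nat + nat \<Rightarrow> real) \<Rightarrow> real) \<Rightarrow> tensor13 \<Rightarrow> tensor13" where
  "hcov0 n L T j i k l z = (\<Sum>m<n. hcov n L T j i k l m z * z (Inr m))"

definition Dtilde :: "nat \<Rightarrow> ((nat + nat \<Rightarrow> real) \<Rightarrow> real) \<Rightarrow> tensor13" where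
  "Dtilde n L = hcov0 n L (douglas_tensor n L)"


section \<open>Classes of Finsler metrics\<close>

definition finsler_metric :: "nat \<Rightarrow> 'm chart set \<Rightarrow> ('m tangent \<Rightarrow> real) \<Rightarrow> bool" where
  "finsler_metric n A F \<longleftrightarrow>
     (\<forall>q \<in> tangent_bundle n A. F q \<ge> 0) \<and>
     (\<forall>c\<in>A. smooth_on_slit n A F c) \<and>
     (\<forall>q \<in> tangent_bundle n A. \<forall>a>0. F (scale_tangent a q) = a * F q) \<and>
     (\<forall>c\<in>A. \<forall>z \<in> slit_dom n c. \<forall>u \<in> coord_space {..<n}. u \<noteq> (\<lambda>_. 0) \<longrightarrow>
        (\<Sum>i<n. \<Sum>j<n. fund_tensor (local_rep n A c F) i j z * u i * u j) > 0)"

definition douglas_metric :: "nat \<Rightarrow> 'm chart set \<Rightarrow> ('m tangent \<Rightarrow> real) \<Rightarrow> bool" where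
  "douglas_metric n A F \<longleftrightarrow> finsler_metric n A F \<and>
     (\<forall>c\<in>A. \<forall>z \<in> slit_dom n c. \<forall>j<n. \<forall>i<n. \<forall>k<n. \<forall>l<n.
        douglas_tensor n (local_rep n A c F) j i k l z = 0)"

text \<open>Smooth (0,1)-tensors \<open>\<mu>\<close> on \<open>TM\<^sub>0\<close>: \<open>\<mu> q c r\<close> is the component \<open>\<mu>\<^sub>r\<close> in the chart \<open>c\<close> at
  \<open>q \<in> TM\<^sub>0\<close>.  As usual in Finsler geometry these live on \<open>TM\<^sub>0\<close> but transform with
  the Jacobian of the base charts.\<close>

definition covector_field :: "nat \<Rightarrow> 'm chart set \<Rightarrow>
    ('m tangent \<Rightarrow> 'm chart \<Rightarrow> nat \<Rightarrow> real) \<Rightarrow> bool" where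
  "covector_field n A \<mu> \<longleftrightarrow>
     (\<forall>q \<in> slit_tangent_bundle n A. \<forall>c\<in>A. \<forall>c'\<in>A.
        fst q \<in> chart_dom c \<and> fst q \<in> chart_dom c' \<longrightarrow>
        (\<forall>r<n. \<mu> q c r = (\<Sum>s<n. jacobian c c' (fst q) s r * \<mu> q c' s))) \<and>
     (\<forall>c\<in>A. \<forall>r<n. smooth_on_slit n A (\<lambda>q. \<mu> q c r) c)"

definition generalized_Dtilde_metric :: "nat \<Rightarrow> 'm chart set \<Rightarrow> ('m tangent \<Rightarrow> real) \<Rightarrow> bool" where
  "generalized_Dtilde_metric n A F \<longleftrightarrow> finsler_metric n A F \<and>
     (\<exists>\<mu>. covector_field n A \<mu> \<and>
       (\<forall>c\<in>A. \<forall>z \<in> slit_dom n c. \<forall>j<n. \<forall>i<n. \<forall>k<n. \<forall>l<n.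
          let L = local_rep n A c F in
          hcov0 n L (Dtilde n L) j i k l z
          + (\<Sum>r<n. local_rep n A c (\<lambda>q. \<mu> q c r) z * Dtilde n L j r k l z) * z (Inr i) = 0))"

end

theory Submission imports Defs
begin

text \<open>
  A Douglas metric satisfies the defining equation with \<open>\<mu> = 0\<close>.  As to properness, in dimension two
  the Douglas tensor of any metric has the form \<open>d y\<^sup>i h\<^sub>j h\<^sub>k h\<^sub>l\<close> with \<open>h = (- y\<^sup>1, y\<^sup>0)\<close>, and
  \<open>|\<^sub>0\<close> preserves this form, acting on the coefficient by a first-order operator.  Hence \<open>\<mu>\<close> with
  \<open>\<mu>\<^sub>r y\<^sup>r = - (coefficient of D~|\<^sub>0) / (coefficient of D~)\<close> exists as soon as the coefficient
  of \<open>D~\<close> vanishes nowhere.  This holds for the Randers metric \<open>F = |y| + b(y)\<close> near the origin of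
  the plane, where \<open>b = (x\<^sup>0 - x\<^sup>1, x\<^sup>0 + x\<^sup>1)\<close>.  Because \<open>db\<close> is constant, its geodesics are
  circles of a fixed radius, \<open>G = |y| h + P y\<close> and \<open>d = -3 |y|\<^sup>-\<^sup>5\<close>, so that the coefficient of
  \<open>D~\<close> is \<open>P d\<close>; the closed part \<open>x\<^sup>0 dx\<^sup>0 + x\<^sup>1 dx\<^sup>1\<close> of \<open>b\<close> only serves to make
  \<open>P = (|y|\<^sup>2 - 2 |y| b(h)) / (2 F)\<close> positive in all directions.
\<close>

section \<open>Partial derivatives and smooth functions\<close>

text \<open>Weaker than relative openness: only small moves along single axes with index in
  \<open>I\<close> must stay in \<open>W\<close>. Partial derivatives see no more than that.\<close>

definition coord_open :: "'i set \<Rightarrow> ('i \<Rightarrow> real) set \<Rightarrow> bool" where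
  "coord_open I W \<longleftrightarrow> (\<forall>z\<in>W. \<forall>i\<in>I. \<forall>\<^sub>F t in nhds (z i). z(i := t) \<in> W)"

text \<open>\<open>pd\<close> is total and carries no information where the slice is not
  differentiable. The relational form keeps differentiability and value together, so that derivative
  rules compose.\<close>

definition has_pd :: "'i \<Rightarrow> (('i \<Rightarrow> real) \<Rightarrow> real) \<Rightarrow> real \<Rightarrow> ('i \<Rightarrow> real) \<Rightarrow> bool" where
  "has_pd i f D z \<longleftrightarrow> ((\<lambda>t. f (z(i := t))) has_real_derivative D) (at (z i))"

lemma has_pd_imp_pd: "has_pd i f D z \<Longrightarrow> pd i f z = D"
  unfolding has_pd_def pd_def by (rule DERIV_imp_deriv)

lemma has_pd_pd:
  "(\<lambda>t. f (z(i := t))) differentiable (at (z i)) \<Longrightarrow> has_pd i f (pd i f z) z"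
  unfolding has_pd_def pd_def
  by (metis DERIV_deriv_iff_real_differentiable)

lemma has_pd_imp_differentiable:
  "has_pd i f D z \<Longrightarrow> (\<lambda>t. f (z(i := t))) differentiable (at (z i))"
  unfolding has_pd_def using real_differentiable_def by blast

lemma has_pd_cong:
  assumes "coord_open I W" "i \<in> I" "z \<in> W" "\<And>w. w \<in> W \<Longrightarrow> f w = g w" "has_pd i g D z"
  shows "has_pd i f D z"
proof -
  have "\<forall>\<^sub>F t in nhds (z i). z(i := t) \<in> W"
    using assms by (auto simp: coord_open_def)
  then have "\<forall>\<^sub>F t in nhds (z i). f (z(i := t)) = g (z(i := t))"
    by (rule eventually_mono) (use assms(4) in auto)
  from DERIV_cong_ev[OF refl this refl] show ?thesis
    using assms(5) unfolding has_pd_def by blast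
qed

text \<open>Near \<open>z\<close> the slice along axis \<open>i\<close> stays in \<open>W\<close>,
  so a closed formula \<open>g\<close> valid only on \<open>W\<close> may be differentiated in place
  of \<open>f\<close>. Iterated derivatives are computed by one application per level.\<close>

lemma pd_eqI:
  assumes "coord_open I W" "i \<in> I" "z \<in> W" "\<And>w. w \<in> W \<Longrightarrow> f w = g w" "has_pd i g D z"
  shows "pd i f z = D"
  using has_pd_cong[OF assms] by (rule has_pd_imp_pd)

text \<open>Leaves the value of the derivative schematic while the rules are applied; it is compared
  with the wanted form only at the end.\<close>

lemma has_pd_eq: "has_pd i f D z \<Longrightarrow> D = E \<Longrightarrow> has_pd i f E z"
  by simp

named_theorems has_pd_intros

lemma has_pd_const [has_pd_intros]: "has_pd i (\<lambda>_. c) 0 z"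
  unfolding has_pd_def by simp

lemma has_pd_coord [has_pd_intros]: "has_pd i (\<lambda>w. w j) (if i = j then 1 else 0) z"
  unfolding has_pd_def by (auto intro!: derivative_eq_intros)

lemma has_pd_add [has_pd_intros]:
  "has_pd i f D z \<Longrightarrow> has_pd i g E z \<Longrightarrow> has_pd i (\<lambda>w. f w + g w) (D + E) z"
  unfolding has_pd_def by (rule DERIV_add)

lemma has_pd_diff [has_pd_intros]:
  "has_pd i f D z \<Longrightarrow> has_pd i g E z \<Longrightarrow> has_pd i (\<lambda>w. f w - g w) (D - E) z"
  unfolding has_pd_def by (rule DERIV_diff)

lemma has_pd_minus [has_pd_intros]:
  "has_pd i f D z \<Longrightarrow> has_pd i (\<lambda>w. - f w) (- D) z"
  unfolding has_pd_def by (rule DERIV_minus)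

lemma has_pd_mult [has_pd_intros]:
  "has_pd i f D z \<Longrightarrow> has_pd i g E z \<Longrightarrow> has_pd i (\<lambda>w. f w * g w) (D * g z + f z * E) z"
  unfolding has_pd_def by (auto intro!: derivative_eq_intros)

lemma has_pd_power [has_pd_intros]:
  "has_pd i f D z \<Longrightarrow> has_pd i (\<lambda>w. f w ^ n) (real n * f z ^ (n - 1) * D) z"
  unfolding has_pd_def by (auto intro!: derivative_eq_intros)

lemma has_pd_inverse [has_pd_intros]:
  "has_pd i f D z \<Longrightarrow> f z \<noteq> 0 \<Longrightarrow> has_pd i (\<lambda>w. inverse (f w)) (- D * (inverse (f z))\<^sup>2) z"
  unfolding has_pd_def by (auto intro!: derivative_eq_intros simp: power2_eq_square)

lemma has_pd_sqrt:
  "has_pd i f D z \<Longrightarrow> f z > 0 \<Longrightarrow> has_pd i (\<lambda>w. sqrt (f w)) (D * inverse (sqrt (f z)) / 2) z"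
  unfolding has_pd_def by (auto intro!: derivative_eq_intros simp: field_simps)

section \<open>Closure properties of C^k and smooth functions\<close>

lemma Ck_on_has_pd:
  "Ck_on (Suc k) I W f \<Longrightarrow> i \<in> I \<Longrightarrow> z \<in> W \<Longrightarrow> has_pd i f (pd i f z) z"
  by (rule has_pd_pd) simp

text \<open>The induction runs over both functions at once, because their partial derivatives in
  turn agree on \<open>W\<close>.\<close>

lemma Ck_on_cong:
  assumes "coord_open I W" "\<And>w. w \<in> W \<Longrightarrow> f w = g w" "Ck_on k I W g"
  shows "Ck_on k I W f"
  using assms(2,3)
proof (induction k arbitrary: f g)
  case 0
  then show ?case
    using continuous_on_cong[OF refl, of W f g] by simp
next
  case (Suc k)
  have hp: "has_pd i f (pd i g z) z" if "i \<in> I" "z \<in> W" for i z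
    by (rule has_pd_cong[OF assms(1) that Suc.prems(1) Ck_on_has_pd[OF Suc.prems(2) that]])
  have "Ck_on k I W (pd i f)" if "i \<in> I" for i
    using Suc.IH[of "pd i f" "pd i g"] has_pd_imp_pd[OF hp[OF that]] Suc.prems(2) that by auto
  moreover have "continuous_on W f"
    using Suc.prems continuous_on_cong[OF refl, of W f g] by simp
  ultimately show ?case
    using has_pd_imp_differentiable[OF hp] by auto
qed

lemma Ck_on_SucI:
  assumes "coord_open I W" "continuous_on W f"
    "\<And>i z. i \<in> I \<Longrightarrow> z \<in> W \<Longrightarrow> has_pd i f (f' i z) z" "\<And>i. i \<in> I \<Longrightarrow> Ck_on k I W (f' i)"
  shows "Ck_on (Suc k) I W f"
proof -
  have "Ck_on k I W (pd i f)" if "i \<in> I" for i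
    by (rule Ck_on_cong[OF assms(1) _ assms(4)[OF that]])
      (use has_pd_imp_pd[OF assms(3)[OF that]] in auto)
  then show ?thesis
    using assms(2) has_pd_imp_differentiable[OF assms(3)] by auto
qed

lemma Ck_on_Suc_imp: "Ck_on (Suc k) I W f \<Longrightarrow> Ck_on k I W f"
  by (induction k arbitrary: f) auto

lemma Ck_on_imp_continuous: "Ck_on k I W f \<Longrightarrow> continuous_on W f"
  by (cases k) auto

lemma Ck_on_const:
  assumes "coord_open I W"
  shows "Ck_on k I W (\<lambda>_. c)"
proof (induction k arbitrary: c)
  case (Suc k)
  show ?case
    by (rule Ck_on_SucI[where f' = "\<lambda>_ _. 0"]) (auto intro: has_pd_const Suc assms)
qed simp

lemma Ck_on_coord:
  assumes "coord_open I W"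
  shows "Ck_on k I W (\<lambda>w. w j)"
proof (cases k)
  case 0
  then show ?thesis
    by (auto intro: continuous_on_subset[OF continuous_on_product_coordinates])
next
  case (Suc k)
  have "Ck_on (Suc k) I W (\<lambda>w. w j)"
    by (rule Ck_on_SucI[where f' = "\<lambda>i _. if i = j then 1 else 0"])
      (auto intro: assms has_pd_coord[THEN has_pd_eq] Ck_on_const
        continuous_on_subset[OF continuous_on_product_coordinates])
  then show ?thesis using Suc by simp
qed

lemma Ck_on_add:
  assumes "coord_open I W" "Ck_on k I W f" "Ck_on k I W g"
  shows "Ck_on k I W (\<lambda>w. f w + g w)"
  using assms(2,3)
proof (induction k arbitrary: f g)
  case 0
  then show ?case by (auto intro: continuous_on_add)
next
  case (Suc k)
  show ?case
    by (rule Ck_on_SucI[OF assms(1), where f' = "\<lambda>i w. pd i f w + pd i g w"])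
      (use Suc in \<open>auto intro!: continuous_on_add has_pd_add has_pd_pd\<close>)
qed

lemma Ck_on_mult:
  assumes "coord_open I W" "Ck_on k I W f" "Ck_on k I W g"
  shows "Ck_on k I W (\<lambda>w. f w * g w)"
  using assms(2,3)
proof (induction k arbitrary: f g)
  case 0
  then show ?case by (auto intro: continuous_on_mult)
next
  case (Suc k)
  \<comment> \<open>In the Leibniz rule the undifferentiated factors appear too, and they are needed
    at level \<open>k\<close>.\<close>
  have f: "Ck_on k I W f" and g: "Ck_on k I W g"
    using Suc.prems Ck_on_Suc_imp by blast+
  show ?case
  proof (rule Ck_on_SucI[OF assms(1), where f' = "\<lambda>i w. pd i f w * g w + f w * pd i g w"])
    show "continuous_on W (\<lambda>w. f w * g w)"
      using Suc.prems by (intro continuous_on_mult Ck_on_imp_continuous)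
    show "has_pd i (\<lambda>w. f w * g w) (pd i f z * g z + f z * pd i g z) z"
      if "i \<in> I" "z \<in> W" for i z
      using Suc.prems that by (auto intro!: has_pd_mult has_pd_pd)
    show "Ck_on k I W (\<lambda>w. pd i f w * g w + f w * pd i g w)" if "i \<in> I" for i
      using Suc.prems that f g by (auto intro!: Ck_on_add[OF assms(1)] Suc.IH)
  qed
qed

text \<open>The derivative - f' / f^2 contains the inverse itself, which is C^k by the induction
  hypothesis.\<close>

lemma Ck_on_inverse:
  assumes "coord_open I W" "Ck_on k I W f" "\<And>z. z \<in> W \<Longrightarrow> f z \<noteq> 0"
  shows "Ck_on k I W (\<lambda>w. inverse (f w))"
  using assms(2,3)
proof (induction k)
  case 0
  then show ?case by (auto intro: continuous_on_inverse)
next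
  case (Suc k)
  have IH: "Ck_on k I W (\<lambda>w. inverse (f w))"
    using Suc Ck_on_Suc_imp by blast
  show ?case
  proof (rule Ck_on_SucI[OF assms(1), where f' = "\<lambda>i w. (-1) * pd i f w * (inverse (f w) * inverse (f w))"])
    show "continuous_on W (\<lambda>w. inverse (f w))"
      using Suc.prems by (intro continuous_on_inverse ballI Ck_on_imp_continuous[OF Suc.prems(1)]) fastforce
    show "has_pd i (\<lambda>w. inverse (f w)) ((-1) * pd i f z * (inverse (f z) * inverse (f z))) z"
      if "i \<in> I" "z \<in> W" for i z
      using has_pd_inverse[OF Ck_on_has_pd[OF Suc.prems(1) that]] Suc.prems(2) that
      by (simp add: power2_eq_square)
    show "Ck_on k I W (\<lambda>w. (-1) * pd i f w * (inverse (f w) * inverse (f w)))" if "i \<in> I" for i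
      by (intro Ck_on_mult[OF assms(1)] IH Ck_on_const[OF assms(1)]) (use Suc.prems that in auto)
  qed
qed

text \<open>The derivative f' / (2 sqrt f) contains the root itself, which is C^k by the induction
  hypothesis and has an inverse since f is positive.\<close>

lemma Ck_on_sqrt:
  assumes "coord_open I W" "Ck_on k I W f" "\<And>z. z \<in> W \<Longrightarrow> f z > 0"
  shows "Ck_on k I W (\<lambda>w. sqrt (f w))"
  using assms(2,3)
proof (induction k)
  case 0
  then show ?case by (auto intro: continuous_on_real_sqrt)
next
  case (Suc k)
  have IH: "Ck_on k I W (\<lambda>w. sqrt (f w))"
    using Suc Ck_on_Suc_imp by blast
  have pos: "sqrt (f z) \<noteq> 0" if "z \<in> W" for z
    using Suc.prems(2)[OF that] by simp
  show ?case
  proof (rule Ck_on_SucI[OF assms(1), where f' = "\<lambda>i w. pd i f w * inverse (sqrt (f w)) * (1/2)"])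
    show "continuous_on W (\<lambda>w. sqrt (f w))"
      using Suc.prems by (intro continuous_on_real_sqrt Ck_on_imp_continuous[OF Suc.prems(1)])
    show "has_pd i (\<lambda>w. sqrt (f w)) (pd i f z * inverse (sqrt (f z)) * (1/2)) z"
      if "i \<in> I" "z \<in> W" for i z
      using has_pd_sqrt[OF Ck_on_has_pd[OF Suc.prems(1) that]] Suc.prems(2) that by simp
    show "Ck_on k I W (\<lambda>w. pd i f w * inverse (sqrt (f w)) * (1/2))" if "i \<in> I" for i
      by (intro Ck_on_mult[OF assms(1)] Ck_on_inverse[OF assms(1)] IH Ck_on_const[OF assms(1)] pos)
        (use Suc.prems that in auto)
  qed
qed

lemma smooth_fun_on_cong:
  "coord_open I W \<Longrightarrow> (\<And>w. w \<in> W \<Longrightarrow> f w = g w) \<Longrightarrow> smooth_fun_on I W g \<Longrightarrow> smooth_fun_on I W f"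
  unfolding smooth_fun_on_def using Ck_on_cong by blast

lemma smooth_fun_on_const: "coord_open I W \<Longrightarrow> smooth_fun_on I W (\<lambda>_. c)"
  unfolding smooth_fun_on_def using Ck_on_const by blast

lemma smooth_fun_on_coord: "coord_open I W \<Longrightarrow> smooth_fun_on I W (\<lambda>w. w j)"
  unfolding smooth_fun_on_def by (simp add: Ck_on_coord)

lemma smooth_fun_on_add:
  "coord_open I W \<Longrightarrow> smooth_fun_on I W f \<Longrightarrow> smooth_fun_on I W g \<Longrightarrow>
    smooth_fun_on I W (\<lambda>w. f w + g w)"
  unfolding smooth_fun_on_def using Ck_on_add by blast

lemma smooth_fun_on_mult:
  "coord_open I W \<Longrightarrow> smooth_fun_on I W f \<Longrightarrow> smooth_fun_on I W g \<Longrightarrow>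
    smooth_fun_on I W (\<lambda>w. f w * g w)"
  unfolding smooth_fun_on_def using Ck_on_mult by blast

lemma smooth_fun_on_diff:
  assumes "coord_open I W" "smooth_fun_on I W f" "smooth_fun_on I W g"
  shows "smooth_fun_on I W (\<lambda>w. f w - g w)"
  using smooth_fun_on_add[OF assms(1,2)
      smooth_fun_on_mult[OF assms(1) smooth_fun_on_const[OF assms(1), of "-1"] assms(3)]]
  by simp

lemma smooth_fun_on_inverse:
  "coord_open I W \<Longrightarrow> smooth_fun_on I W f \<Longrightarrow> (\<And>z. z \<in> W \<Longrightarrow> f z \<noteq> 0) \<Longrightarrow>
    smooth_fun_on I W (\<lambda>w. inverse (f w))"
  unfolding smooth_fun_on_def using Ck_on_inverse by blast

lemma smooth_fun_on_sqrt:
  "coord_open I W \<Longrightarrow> smooth_fun_on I W f \<Longrightarrow> (\<And>z. z \<in> W \<Longrightarrow> f z > 0) \<Longrightarrow>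
    smooth_fun_on I W (\<lambda>w. sqrt (f w))"
  unfolding smooth_fun_on_def using Ck_on_sqrt by blast

lemma smooth_fun_on_pd: "smooth_fun_on I W f \<Longrightarrow> i \<in> I \<Longrightarrow> smooth_fun_on I W (pd i f)"
  unfolding smooth_fun_on_def
proof (intro allI)
  fix k
  assume "\<forall>k. Ck_on k I W f" "i \<in> I"
  from spec[OF this(1), of "Suc k"] this(2) show "Ck_on k I W (pd i f)"
    by simp
qed

lemma smooth_fun_on_has_pd:
  "smooth_fun_on I W f \<Longrightarrow> i \<in> I \<Longrightarrow> z \<in> W \<Longrightarrow> has_pd i f (pd i f z) z"
  unfolding smooth_fun_on_def by (rule Ck_on_has_pd) auto

text \<open>Varying one coordinate is a continuous curve in the product topology, and an index in
  \<open>I\<close> keeps it inside \<open>coord_space I\<close>.\<close>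

lemma coord_open_openin:
  assumes "openin (top_of_set (coord_space I)) W"
  shows "coord_open I W"
  unfolding coord_open_def
proof (intro ballI)
  fix x m assume x: "x \<in> W" and m: "m \<in> I"
  from assms obtain T where T: "open T" "W = coord_space I \<inter> T"
    by (auto simp: openin_open)
  have "continuous_on UNIV (\<lambda>t. x(m := t))"
  proof (rule continuous_on_coordinatewise_then_product)
    show "continuous_on UNIV (\<lambda>t. (x(m := t)) i)" for i
      by (cases "i = m") auto
  qed
  then have "open ((\<lambda>t. x(m := t)) -` T)"
    using T(1) by (simp add: continuous_on_open_vimage)
  then have "\<forall>\<^sub>F t in nhds (x m). x(m := t) \<in> T"
    using x T(2) eventually_nhds[of _ "x m"] by auto
  moreover have "x(m := t) \<in> coord_space I" for t
    using x T(2) m by (auto simp: coord_space_def)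
  ultimately show "\<forall>\<^sub>F t in nhds (x m). x(m := t) \<in> W"
    using T(2) by simp
qed

lemma coord_open_slit_dom:
  assumes "openin (top_of_set (coord_space {..<n})) (chart_map c ` chart_dom c)"
  shows "coord_open ({..<n} <+> {..<n}) (slit_dom n c)"
  unfolding coord_open_def
proof (intro ballI)
  fix z i assume z: "z \<in> slit_dom n c" and i: "i \<in> {..<n} <+> {..<n}"
  from z obtain x y where xy: "z = case_sum x y" "x \<in> chart_map c ` chart_dom c"
    "y \<in> coord_space {..<n}" "y \<noteq> (\<lambda>_. 0)"
    by (auto simp: slit_dom_def)
  show "\<forall>\<^sub>F t in nhds (z i). z(i := t) \<in> slit_dom n c"
  proof (cases i)
    case (Inl m)
    then have m: "m < n" using i by auto
    have "\<forall>\<^sub>F t in nhds (x m). x(m := t) \<in> chart_map c ` chart_dom c"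
      using coord_open_openin[OF assms] xy(2) m by (auto simp: coord_open_def)
    moreover have "z(i := t) = case_sum (x(m := t)) y" for t
      by (auto simp: xy(1) Inl fun_eq_iff split: sum.splits)
    ultimately show ?thesis
      unfolding slit_dom_def using xy(1,3,4) Inl by (auto elim!: eventually_mono)
  next
    case (Inr m)
    then have m: "m < n" using i by auto
    \<comment> \<open>One nonzero component \<open>k\<close> certifies that the vector is nonzero.
      It survives small changes of component \<open>m\<close>, also when
      \<open>k = m\<close>.\<close>
    obtain k where k: "y k \<noteq> 0" using xy(4) by auto
    have ev: "\<forall>\<^sub>F t in nhds (y m). (y(m := t)) k \<noteq> 0"
      using k t1_space_nhds[of "y k" 0] by (cases "k = m") auto
    have "y(m := t) \<in> coord_space {..<n}" for t
      using xy(3) m by (auto simp: coord_space_def)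
    moreover have "z(i := t) = case_sum x (y(m := t))" for t
      by (auto simp: xy(1) Inr fun_eq_iff split: sum.splits)
    ultimately have "z(i := t) \<in> slit_dom n c" if "(y(m := t)) k \<noteq> 0" for t
      unfolding slit_dom_def using xy(2) that by fastforce
    then show ?thesis
      using eventually_mono[OF ev] xy(1) Inr by simp
  qed
qed

section \<open>Douglas metrics\<close>

text \<open>Every term of \<open>hcov\<close> contains a component of \<open>T\<close> or a first
  derivative of one, and these derivatives vanish because the slices near \<open>z\<close> stay in
  \<open>W\<close>.\<close>

lemma hcov0_eq_0:
  assumes W: "coord_open ({..<n} <+> {..<n}) W" and "z \<in> W"
    and T: "\<And>j i k l w. j < n \<Longrightarrow> i < n \<Longrightarrow> k < n \<Longrightarrow> l < n \<Longrightarrow> w \<in> W \<Longrightarrow> T j i k l w = 0"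
    and "j < n" "i < n" "k < n" "l < n"
  shows "hcov0 n L T j i k l z = 0"
proof -
  have pd: "pd v (T j i k l) z = 0" if "v \<in> {..<n} <+> {..<n}" for v
    by (rule pd_eqI[OF W that \<open>z \<in> W\<close> _ has_pd_const]) (use assms in auto)
  have "pdx m (T j i k l) z = 0" "pdy m (T j i k l) z = 0" if "m < n" for m
    using that by (auto intro!: pd)
  then show ?thesis
    using assms by (auto simp: hcov0_def hcov_def Let_def intro!: sum.neutral)
qed

lemma douglas_imp_generalized_Dtilde:
  assumes "smooth_manifold n X A" "douglas_metric n A F"
  shows "generalized_Dtilde_metric n A F"
proof -
  have co: "coord_open ({..<n} <+> {..<n}) (slit_dom n c)" if "c \<in> A" for c
    using assms(1) that by (intro coord_open_slit_dom) (auto simp: smooth_manifold_def)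
  define \<mu> :: "'a tangent \<Rightarrow> 'a chart \<Rightarrow> nat \<Rightarrow> real" where "\<mu> = (\<lambda>_ _ _. 0)"
  have \<mu>: "covector_field n A \<mu>"
    unfolding covector_field_def \<mu>_def smooth_on_slit_def local_rep_def
    using smooth_fun_on_const[OF co] by auto
  have "hcov0 n L (Dtilde n L) j i k l z = 0 \<and> (\<forall>r<n. Dtilde n L j r k l z = 0)"
    if "c \<in> A" "z \<in> slit_dom n c" "j < n" "i < n" "k < n" "l < n" "L = local_rep n A c F"
    for c z i j k l L
  proof -
    have D: "douglas_tensor n L j i k l w = 0"
      if "j < n" "i < n" "k < n" "l < n" "w \<in> slit_dom n c" for j i k l w
      using assms(2) that \<open>c \<in> A\<close> \<open>L = _\<close> by (auto simp: douglas_metric_def)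
    \<comment> \<open>Vanishing passes from the Douglas tensor to its covariant derivative along y,
      and in the next step once more.\<close>
    have Dt: "Dtilde n L j i k l w = 0"
      if "j < n" "i < n" "k < n" "l < n" "w \<in> slit_dom n c" for j i k l w
      unfolding Dtilde_def by (rule hcov0_eq_0[OF co[OF \<open>c \<in> A\<close>] that(5) D that(1-4)])
    show ?thesis
      using hcov0_eq_0[OF co[OF \<open>c \<in> A\<close>] that(2) Dt that(3-6)] Dt that by auto
  qed
  with \<mu> show ?thesis
    using assms(2)
    unfolding generalized_Dtilde_metric_def douglas_metric_def Let_def local_rep_def \<mu>_def
    by (intro conjI exI[of _ "\<lambda>_ _ _. 0"]) auto
qed

section \<open>Sprays in dimension two\<close>

lemma sum_lessThan_2: "(\<Sum>i<2. f i) = f 0 + f (1::nat)" for f :: "nat \<Rightarrow> real"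
  by (simp add: numeral_2_eq_2)

text \<open>The inverse matrix is unique when the determinant is nonzero, so the spray can be
  identified by checking a linear system instead of inverting the fundamental tensor.\<close>

lemma spray_2_eqI:
  fixes L z
  defines "g \<equiv> \<lambda>i j. fund_tensor L i j z"
  assumes det: "g 0 0 * g 1 1 - g 0 1 * g 1 0 \<noteq> 0"
    and G: "\<And>l. l < 2 \<Longrightarrow> (\<Sum>m<2. g l m * G m) =
      ((\<Sum>k<2. pdx k (pdy l (\<lambda>w. (L w)\<^sup>2)) z * z (Inr k)) - pdx l (\<lambda>w. (L w)\<^sup>2) z) / 4"
    and "i < 2"
  shows "spray 2 L i z = G i"
proof -
  define d where "d = g 0 0 * g 1 1 - g 0 1 * g 1 0"
  have d: "d \<noteq> 0" using det by (simp add: d_def)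
  \<comment> \<open>The adjugate over the determinant, extended by 0 off the index range as
    \<open>inverse_fund_tensor\<close> demands.\<close>
  define h0 where "h0 = (\<lambda>(i::nat) (j::nat). if i = 0 \<and> j = 0 then g 1 1 / d else if i = 0 \<and> j = 1 then - g 0 1 / d
    else if i = 1 \<and> j = 0 then - g 1 0 / d else if i = 1 \<and> j = 1 then g 0 0 / d else 0)"
  define Q where "Q = (\<lambda>h::nat \<Rightarrow> nat \<Rightarrow> real.
     (\<forall>i<2. \<forall>j<2. (\<Sum>l<2. h i l * g l j) = (if i = j then 1 else 0)) \<and>
     (\<forall>i j. \<not> (i < 2 \<and> j < 2) \<longrightarrow> h i j = 0))"
  have QD: "h i 0 * g 0 j + h i 1 * g 1 j = (if i = j then 1 else 0)"
    if "Q h" "i < 2" "j < 2" for h i j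
    using that by (auto simp: Q_def sum_lessThan_2)
  have "Q h0"
    unfolding Q_def
    by (auto simp: less_2_cases_iff sum_lessThan_2 h0_def field_simps d) (auto simp: d_def algebra_simps)
  moreover have "h = h0" if "Q h" for h
  proof (intro ext)
    fix i j
    have "h i 0 = ((if i = 0 then 1 else 0) * g 1 1 - (if i = 1 then 1 else 0) * g 1 0) / d"
      "h i 1 = ((if i = 1 then 1 else 0) * g 0 0 - (if i = 0 then 1 else 0) * g 0 1) / d"
      if "i < 2"
    proof -
      \<comment> \<open>Uniqueness by Cramer's rule: eliminate one of the two unknowns of row
        \<open>i\<close> from its two equations.\<close>
      have "h i 0 * d = (h i 0 * g 0 0 + h i 1 * g 1 0) * g 1 1 - (h i 0 * g 0 1 + h i 1 * g 1 1) * g 1 0"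
        "h i 1 * d = (h i 0 * g 0 1 + h i 1 * g 1 1) * g 0 0 - (h i 0 * g 0 0 + h i 1 * g 1 0) * g 0 1"
        by (auto simp: d_def algebra_simps)
      then have "h i 0 * d = (if i = 0 then 1 else 0) * g 1 1 - (if i = 1 then 1 else 0) * g 1 0"
        "h i 1 * d = (if i = 1 then 1 else 0) * g 0 0 - (if i = 0 then 1 else 0) * g 0 1"
        using QD[OF \<open>Q h\<close> that, of 0] QD[OF \<open>Q h\<close> that, of 1] by simp_all
      then show "h i 0 = ((if i = 0 then 1 else 0) * g 1 1 - (if i = 1 then 1 else 0) * g 1 0) / d"
        "h i 1 = ((if i = 1 then 1 else 0) * g 0 0 - (if i = 0 then 1 else 0) * g 0 1) / d"
        using d by (simp_all add: nonzero_eq_divide_eq)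
    qed
    moreover have "h i j = h0 i j" if "\<not> (i < 2 \<and> j < 2)"
      using \<open>Q h\<close> that by (auto simp: Q_def h0_def less_2_cases_iff)
    ultimately show "h i j = h0 i j"
      by (cases "i < 2 \<and> j < 2") (auto simp: less_2_cases_iff h0_def)
  qed
  ultimately have "(THE h. Q h) = h0"
    by (rule the_equality)
  then have inv: "inverse_fund_tensor 2 L z = h0"
    by (simp add: inverse_fund_tensor_def Q_def g_def)
  have "spray 2 L i z = (\<Sum>l<2. h0 i l * (\<Sum>m<2. g l m * G m))"
    unfolding spray_def inv by (subst sum_distrib_left, rule sum.cong) (simp_all add: G)
  also have "\<dots> = (h0 i 0 * g 0 0 + h0 i 1 * g 1 0) * G 0 + (h0 i 0 * g 0 1 + h0 i 1 * g 1 1) * G 1"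
    by (simp add: sum_lessThan_2 algebra_simps)
  also have "\<dots> = G i"
    using QD[OF \<open>Q h0\<close> \<open>i < 2\<close>, of 0] QD[OF \<open>Q h0\<close> \<open>i < 2\<close>, of 1] \<open>i < 2\<close>
    by (auto simp: less_2_cases_iff)
  finally show ?thesis .
qed

section \<open>Homogeneity of degree k in y, in the infinitesimal form of Euler's identity at a
  point\<close>

definition euler :: "real \<Rightarrow> ((nat + nat \<Rightarrow> real) \<Rightarrow> real) \<Rightarrow> (nat + nat \<Rightarrow> real) \<Rightarrow> bool" where
  "euler k f z \<longleftrightarrow> (\<exists>D. (\<forall>m<2. has_pd (Inr m) f (D m) z) \<and> (\<Sum>m<2. z (Inr m) * D m) = k * f z)"

text \<open>Partial derivatives are unique, so the identity holds for any explicit family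
  \<open>D\<close>. This turns homogeneity into contraction identities for the metric, the
  projective factor and the spray.\<close>

lemma euler_has_pd:
  assumes "euler k f z" "\<And>m. m < 2 \<Longrightarrow> has_pd (Inr m) f (D m) z"
  shows "(\<Sum>m<2. z (Inr m) * D m) = k * f z"
proof -
  obtain E where E: "\<forall>m<2. has_pd (Inr m) f (E m) z" "(\<Sum>m<2. z (Inr m) * E m) = k * f z"
    using assms(1) by (auto simp: euler_def)
  have "D m = E m" if "m < 2" for m
    using assms(2)[OF that] E(1) that by (metis has_pd_imp_pd)
  with E(2) show ?thesis by simp
qed

lemma euler_imp_has_pd: "euler k f z \<Longrightarrow> m < 2 \<Longrightarrow> has_pd (Inr m) f (pdy m f z) z"
  unfolding euler_def by (metis has_pd_imp_pd)

lemma euler_pd: "euler k f z \<Longrightarrow> (\<Sum>m<2. z (Inr m) * pdy m f z) = k * f z"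
  by (rule euler_has_pd) (auto intro: euler_imp_has_pd)

text \<open>The introduction rules produce degrees such as \<open>0 + (1 + 1) + - 1\<close>; they
  are evaluated only at the end.\<close>

lemma euler_cong: "euler k f z \<Longrightarrow> k = l \<Longrightarrow> euler l f z"
  by simp

named_theorems euler_intros

lemma euler_const [euler_intros]: "euler 0 (\<lambda>_. c) z"
  unfolding euler_def by (auto intro!: exI[of _ "\<lambda>_. 0"] has_pd_const)

lemma euler_y [euler_intros]: "i < 2 \<Longrightarrow> euler 1 (\<lambda>w. w (Inr i)) z"
  unfolding euler_def
  by (rule exI[of _ "\<lambda>m. if m = i then 1 else 0"])
    (auto simp: sum_lessThan_2 less_2_cases_iff intro!: has_pd_coord[THEN has_pd_eq])

lemma euler_add [euler_intros]:
  assumes "euler k f z" "euler l g z" "k = l" shows "euler k (\<lambda>w. f w + g w) z"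
proof -
  obtain D E where "\<forall>m<2. has_pd (Inr m) f (D m) z" "(\<Sum>m<2. z (Inr m) * D m) = k * f z"
    "\<forall>m<2. has_pd (Inr m) g (E m) z" "(\<Sum>m<2. z (Inr m) * E m) = l * g z"
    using assms(1,2) unfolding euler_def by blast
  with \<open>k = l\<close> show ?thesis
    unfolding euler_def
    by (intro exI[of _ "\<lambda>m. D m + E m"]) (auto simp: sum_lessThan_2 algebra_simps intro!: has_pd_add)
qed

lemma euler_mult [euler_intros]:
  assumes "euler k f z" "euler l g z" shows "euler (k + l) (\<lambda>w. f w * g w) z"
proof -
  obtain D E where D: "\<forall>m<2. has_pd (Inr m) f (D m) z" "(\<Sum>m<2. z (Inr m) * D m) = k * f z"
    "\<forall>m<2. has_pd (Inr m) g (E m) z" "(\<Sum>m<2. z (Inr m) * E m) = l * g z"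
    using assms(1,2) unfolding euler_def by blast
  have "(\<Sum>m<2. z (Inr m) * (D m * g z + f z * E m)) =
      (\<Sum>m<2. z (Inr m) * D m) * g z + f z * (\<Sum>m<2. z (Inr m) * E m)"
    by (simp add: sum_lessThan_2 algebra_simps)
  with D show ?thesis
    unfolding euler_def
    by (intro exI[of _ "\<lambda>m. D m * g z + f z * E m"]) (simp add: has_pd_mult distrib_right)
qed

lemma euler_diff [euler_intros]:
  assumes "euler k f z" "euler l g z" "k = l" shows "euler k (\<lambda>w. f w - g w) z"
proof -
  have "euler k (\<lambda>w. f w + (-1) * g w) z"
    by (rule euler_add euler_mult euler_const assms)+ (simp add: assms)
  then show ?thesis by simp
qed

lemma euler_inverse [euler_intros]:
  assumes "euler k f z" "f z \<noteq> 0" shows "euler (- k) (\<lambda>w. inverse (f w)) z"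
proof -
  obtain D where D: "\<forall>m<2. has_pd (Inr m) f (D m) z" "(\<Sum>m<2. z (Inr m) * D m) = k * f z"
    using assms(1) unfolding euler_def by blast
  have "(\<Sum>m<2. z (Inr m) * (- D m * (inverse (f z))\<^sup>2)) = - (\<Sum>m<2. z (Inr m) * D m) * (inverse (f z))\<^sup>2"
    by (simp add: sum_lessThan_2 algebra_simps)
  also have "\<dots> = - k * inverse (f z)"
    using D(2) assms(2) by (simp add: power2_eq_square)
  finally show ?thesis
    unfolding euler_def using D(1) assms(2)
    by (intro exI[of _ "\<lambda>m. - D m * (inverse (f z))\<^sup>2"]) (auto simp add: has_pd_inverse[THEN has_pd_eq])
qed

text \<open>The vector y after a quarter turn, that is, the h of the overview. It serves both as the
  covector h_j, which annihilates y, and as a vector h^i.\<close>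

definition rot :: "nat \<Rightarrow> (nat + nat \<Rightarrow> real) \<Rightarrow> real" where
  "rot i z = (if i = 0 then - z (Inr 1) else z (Inr 0))"

definition rot_deriv :: "nat \<Rightarrow> nat \<Rightarrow> real" where
  "rot_deriv i m = (if i = 0 then if m = 1 then -1 else 0 else if m = 0 then 1 else 0)"

lemma has_pd_rot_y [has_pd_intros]: "m < 2 \<Longrightarrow> has_pd (Inr m) (rot i) (rot_deriv i m) z"
  unfolding rot_def[abs_def] rot_deriv_def
  by (cases "i = 0")
    (auto simp: less_2_cases_iff intro!: has_pd_minus[THEN has_pd_eq] has_pd_coord[THEN has_pd_eq])

lemma has_pd_rot_x [has_pd_intros]: "has_pd (Inl m) (rot i) 0 z"
  unfolding rot_def[abs_def]
  by (cases "i = 0")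
    (auto intro!: has_pd_minus[THEN has_pd_eq] has_pd_coord[THEN has_pd_eq])

lemma euler_rot [euler_intros]: "euler 1 (rot i) z"
  unfolding euler_def
  by (intro exI[of _ "rot_deriv i"] conjI allI impI has_pd_rot_y)
    (auto simp: sum_lessThan_2 rot_def rot_deriv_def)

text \<open>For \<open>N r m = G\<^sup>r\<^sub>.\<^sub>m\<close> this is the action of \<open>|\<^sub>0\<close> on the coefficient \<open>t\<close> of a tensor
  \<open>t y\<^sup>i h\<^sub>j h\<^sub>k h\<^sub>l\<close>; each factor \<open>h\<close> contributes one trace of \<open>N\<close>.\<close>

definition transport :: "(nat \<Rightarrow> nat \<Rightarrow> (nat + nat \<Rightarrow> real) \<Rightarrow> real) \<Rightarrow>
    ((nat + nat \<Rightarrow> real) \<Rightarrow> real) \<Rightarrow> (nat + nat \<Rightarrow> real) \<Rightarrow> real" where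
  "transport N t z = (\<Sum>m<2. z (Inr m) * pdx m t z)
     - (\<Sum>r<2. (\<Sum>m<2. z (Inr m) * N r m z) * pdy r t z) - 3 * (N 0 0 z + N 1 1 z) * t z"

text \<open>The connection term of the upper index cancels the derivative of the factor y^i. For a
  lower index, write h = J y with J the quarter turn: J N + N^T J = (trace N) J in dimension two,
  which leaves minus one trace per factor h.\<close>

lemma hcov0_2_rot_multiple:
  fixes t :: "(nat + nat \<Rightarrow> real) \<Rightarrow> real"
  assumes W: "coord_open ({..<2} <+> {..<2}) W" and z: "z \<in> W"
    and N: "\<And>i m w. i < 2 \<Longrightarrow> m < 2 \<Longrightarrow> w \<in> W \<Longrightarrow> pdy m (spray 2 L i) w = N i m w"
    and eN: "\<And>i m. i < 2 \<Longrightarrow> m < 2 \<Longrightarrow> euler 1 (N i m) z"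
    and T: "\<And>j i k l w. j < 2 \<Longrightarrow> i < 2 \<Longrightarrow> k < 2 \<Longrightarrow> l < 2 \<Longrightarrow> w \<in> W \<Longrightarrow>
      T j i k l w = t w * (w (Inr i) * (rot j w * (rot k w * rot l w)))"
    and t: "smooth_fun_on ({..<2} <+> {..<2}) W t"
    and ijkl: "j < 2" "i < 2" "k < 2" "l < 2"
  shows "hcov0 2 L T j i k l z =
    transport N t z * (z (Inr i) * (rot j z * (rot k z * rot l z)))"
proof -
  define g where "g = (\<lambda>i r m. pdy m (N i r) z)"
  have \<Gamma>: "pdy m (pdy r (spray 2 L i)) z = g i r m" if "i < 2" "r < 2" "m < 2" for i r m
  proof -
    note D = euler_imp_has_pd[OF eN[OF that(1,2)] that(3)]
    show ?thesis
      unfolding g_def by (rule pd_eqI[OF W _ z _ D]) (use N that in auto)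
  qed
  \<comment> \<open>Euler's identity for N says that y^m G^i_{.r.m} = N^i_r. It turns every
    connection term of \<open>hcov0\<close> into a term in \<open>N\<close>.\<close>
  have gN: "N i r z = z (Inr 0) * g i r 0 + z (Inr 1) * g i r 1" if "i < 2" "r < 2" for i r
    using euler_pd[OF eN[OF that]] by (simp add: g_def sum_lessThan_2)
  have pdx: "pdx m (T j i k l) z = pdx m t z * (z (Inr i) * (rot j z * (rot k z * rot l z)))"
    if "m < 2" for m
  proof -
    have m: "Inl m \<in> {..<2} <+> {..<2::nat}" using that by auto
    show ?thesis
      by (rule pd_eqI[OF W m z T[OF ijkl]])
        (assumption, rule has_pd_eq, (rule has_pd_intros smooth_fun_on_has_pd[OF t m z])+, simp)
  qed
  have pdy: "pdy m (T j i k l) z = pdy m t z * (z (Inr i) * (rot j z * (rot k z * rot l z))) +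
     t z * ((if m = i then 1 else 0) * (rot j z * (rot k z * rot l z)) + z (Inr i) *
       (rot_deriv j m * (rot k z * rot l z) + rot j z * (rot_deriv k m * rot l z + rot k z * rot_deriv l m)))"
    if "m < 2" for m
  proof -
    have m: "Inr m \<in> {..<2} <+> {..<2::nat}" using that by auto
    show ?thesis
      by (rule pd_eqI[OF W m z T[OF ijkl]])
        (assumption, rule has_pd_eq, (rule that has_pd_intros smooth_fun_on_has_pd[OF t m z])+, simp)
  qed
  define Y where "Y = (\<lambda>j i k l. T j i k l z)"
  have "hcov0 2 L T j i k l z = (\<Sum>m<2. z (Inr m) * pdx m (T j i k l) z)
     - (\<Sum>r<2. (\<Sum>m<2. z (Inr m) * N r m z) * pdy r (T j i k l) z)
     + (\<Sum>r<2. Y j r k l * N i r z) - (\<Sum>r<2. Y r i k l * N r j z)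
     - (\<Sum>r<2. Y j i r l * N r k z) - (\<Sum>r<2. Y j i k r * N r l z)"
    unfolding hcov0_def hcov_def Let_def Y_def
    by (simp add: sum_lessThan_2 \<Gamma> ijkl N z gN algebra_simps)
  also have "\<dots> = transport N t z * (z (Inr i) * (rot j z * (rot k z * rot l z)))"
  proof -
    have Y: "Y j i k l = t z * (z (Inr i) * (rot j z * (rot k z * rot l z)))"
      if "j < 2" "i < 2" "k < 2" "l < 2" for j i k l
      using T z that by (simp add: Y_def)
    have *: "0 < (2::nat)" "1 < (2::nat)" by auto
    \<comment> \<open>With all sums expanded, each of the 16 choices of indices is a polynomial
      identity.\<close>
    show ?thesis
      unfolding sum_lessThan_2 transport_def pdx[OF *(1)] pdx[OF *(2)] pdy[OF *(1)] pdy[OF *(2)]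
        Y[OF *(1) ijkl(2-4)] Y[OF *(2) ijkl(2-4)] Y[OF ijkl(1) *(1) ijkl(3,4)] Y[OF ijkl(1) *(2) ijkl(3,4)]
        Y[OF ijkl(1,2) *(1) ijkl(4)] Y[OF ijkl(1,2) *(2) ijkl(4)] Y[OF ijkl(1-3) *(1)] Y[OF ijkl(1-3) *(2)]
      using ijkl[THEN less_2_cases]
      by (elim disjE; simp add: rot_def rot_deriv_def algebra_simps)
  qed
  finally show ?thesis .
qed

section \<open>A Randers metric with circular geodesics\<close>

text \<open>The form b has Euclidean norm sqrt 2 |x|, so the bound 1/8 means |b| < 1/2. This gives F
  > 0 and also P > 0, which needs 2 |b(h)| < |y|.\<close>

definition disc :: "(nat \<Rightarrow> real) set" where
  "disc = {x \<in> coord_space {..<2}. (x 0)\<^sup>2 + (x 1)\<^sup>2 < 1/8}"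

definition disc_chart :: "(nat \<Rightarrow> real) chart" where
  "disc_chart = (disc, \<lambda>p. p)"

abbreviation disc_slit :: "(nat + nat \<Rightarrow> real) set" where
  "disc_slit \<equiv> slit_dom 2 disc_chart"

lemma openin_disc: "openin (top_of_set (coord_space {..<2})) disc"
proof -
  have "open {x :: nat \<Rightarrow> real. (x 0)\<^sup>2 + (x 1)\<^sup>2 < 1/8}"
    by (intro open_Collect_less continuous_on_add continuous_on_power continuous_on_const
        continuous_on_product_coordinates)
  moreover have "disc = coord_space {..<2} \<inter> {x. (x 0)\<^sup>2 + (x 1)\<^sup>2 < 1/8}"
    by (auto simp: disc_def)
  ultimately show ?thesis
    by (auto simp: openin_open)
qed

lemma coord_open_disc_slit: "coord_open ({..<2} <+> {..<2}) disc_slit"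
  by (rule coord_open_slit_dom) (simp add: disc_chart_def openin_disc)

definition ylen :: "(nat + nat \<Rightarrow> real) \<Rightarrow> real" where
  "ylen z = sqrt ((z (Inr 0))\<^sup>2 + (z (Inr 1))\<^sup>2)"

definition bform :: "nat \<Rightarrow> (nat + nat \<Rightarrow> real) \<Rightarrow> real" where
  "bform i z = (if i = 0 then z (Inl 0) - z (Inl 1) else z (Inl 0) + z (Inl 1))"

definition bform_deriv :: "nat \<Rightarrow> nat \<Rightarrow> real" where
  "bform_deriv i k = (if i = 0 \<and> k = 1 then -1 else 1)"

definition randers :: "(nat + nat \<Rightarrow> real) \<Rightarrow> real" where
  "randers z = ylen z + (bform 0 z * z (Inr 0) + bform 1 z * z (Inr 1))"

definition bcross :: "(nat + nat \<Rightarrow> real) \<Rightarrow> real" where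
  "bcross z = bform 0 z * rot 0 z + bform 1 z * rot 1 z"

definition proj_factor :: "(nat + nat \<Rightarrow> real) \<Rightarrow> real" where
  "proj_factor z = (1/2) * (ylen z * (ylen z - 2 * bcross z)) * inverse (randers z)"

definition randers_spray :: "nat \<Rightarrow> (nat + nat \<Rightarrow> real) \<Rightarrow> real" where
  "randers_spray i z = ylen z * rot i z + proj_factor z * z (Inr i)"

lemma disc_slitD:
  assumes "z \<in> disc_slit"
  shows "(z (Inl 0))\<^sup>2 + (z (Inl 1))\<^sup>2 < 1/8" "(z (Inr 0))\<^sup>2 + (z (Inr 1))\<^sup>2 > 0"
proof -
  obtain x y where xy: "z = case_sum x y" "x \<in> disc" "y \<in> coord_space {..<2}" "y \<noteq> (\<lambda>_. 0)"
    using assms by (auto simp: slit_dom_def disc_chart_def)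
  show "(z (Inl 0))\<^sup>2 + (z (Inl 1))\<^sup>2 < 1/8"
    using xy by (auto simp: disc_def)
  obtain i where i: "y i \<noteq> 0" using xy(4) by auto
  then have "i < 2" using xy(3) by (force simp: coord_space_def)
  then have "y 0 \<noteq> 0 \<or> y 1 \<noteq> 0"
    using i by (auto simp: less_2_cases_iff)
  then show "(z (Inr 0))\<^sup>2 + (z (Inr 1))\<^sup>2 > 0"
    by (auto simp: xy(1) sum_power2_gt_zero_iff)
qed

lemma ylen_pos: "z \<in> disc_slit \<Longrightarrow> ylen z > 0"
  using disc_slitD(2) by (simp add: ylen_def)

lemma ylen_power2: "(ylen z)\<^sup>2 = (z (Inr 0))\<^sup>2 + (z (Inr 1))\<^sup>2"
  by (simp add: ylen_def)

text \<open>Lagrange's identity together with |b|^2 = 2 |x|^2 < 1/4. The pair \<open>u\<close>,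
  \<open>v\<close> will be y or its quarter turn. The weak bound covers y = 0, where F has to be
  nonnegative as well.\<close>

lemma bform_bound:
  assumes "(z (Inl 0))\<^sup>2 + (z (Inl 1))\<^sup>2 < 1/8" "u\<^sup>2 + v\<^sup>2 = (ylen z)\<^sup>2"
  shows "\<bar>bform 0 z * u + bform 1 z * v\<bar> \<le> ylen z / 2"
    "ylen z > 0 \<Longrightarrow> \<bar>bform 0 z * u + bform 1 z * v\<bar> < ylen z / 2"
proof -
  let ?x = "z (Inl 0)" and ?x' = "z (Inl 1)"
  have "(bform 0 z * u + bform 1 z * v)\<^sup>2 + (bform 0 z * v - bform 1 z * u)\<^sup>2
      = 2 * (?x\<^sup>2 + ?x'\<^sup>2) * (u\<^sup>2 + v\<^sup>2)"
    by (simp add: bform_def power2_eq_square algebra_simps)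
  then have le: "(bform 0 z * u + bform 1 z * v)\<^sup>2 \<le> 2 * (?x\<^sup>2 + ?x'\<^sup>2) * (ylen z)\<^sup>2"
    unfolding assms(2) by (metis le_add_same_cancel1 zero_le_power2)
  also have "\<dots> \<le> (1/4) * (ylen z)\<^sup>2"
    using assms(1) by (intro mult_right_mono) auto
  finally have "(bform 0 z * u + bform 1 z * v)\<^sup>2 \<le> (ylen z / 2)\<^sup>2"
    by (simp add: power_divide)
  then show "\<bar>bform 0 z * u + bform 1 z * v\<bar> \<le> ylen z / 2"
    unfolding abs_le_square_iff[symmetric] by (simp add: ylen_def)
  assume pos: "ylen z > 0"
  then have "2 * (?x\<^sup>2 + ?x'\<^sup>2) * (ylen z)\<^sup>2 < (1/4) * (ylen z)\<^sup>2"
    using assms(1) by (intro mult_strict_right_mono) auto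
  with le have "(bform 0 z * u + bform 1 z * v)\<^sup>2 < (ylen z / 2)\<^sup>2"
    by (simp add: power_divide)
  then show "\<bar>bform 0 z * u + bform 1 z * v\<bar> < ylen z / 2"
    using power2_less_imp_less[of "\<bar>bform 0 z * u + bform 1 z * v\<bar>" "ylen z / 2"] pos by simp
qed

lemma randers_pos:
  assumes "z \<in> disc_slit" shows "randers z > 0"
proof -
  have "\<bar>bform 0 z * z (Inr 0) + bform 1 z * z (Inr 1)\<bar> < ylen z / 2"
    by (rule bform_bound(2)[OF disc_slitD(1)[OF assms] _ ylen_pos[OF assms]])
      (simp add: ylen_power2)
  then show ?thesis
    using ylen_pos[OF assms] unfolding randers_def by linarith
qed

lemma proj_factor_pos:
  assumes "z \<in> disc_slit" shows "proj_factor z > 0"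
proof -
  have "\<bar>bcross z\<bar> < ylen z / 2"
    unfolding bcross_def
    by (rule bform_bound(2)[OF disc_slitD(1)[OF assms] _ ylen_pos[OF assms]])
      (simp add: ylen_power2 rot_def)
  then have "ylen z - 2 * bcross z > 0"
    by linarith
  then show ?thesis
    using randers_pos[OF assms] ylen_pos[OF assms] by (simp add: proj_factor_def)
qed

lemma has_pd_ylen_y [has_pd_intros]:
  assumes "m < 2" "ylen z > 0"
  shows "has_pd (Inr m) ylen (z (Inr m) * inverse (ylen z)) z"
proof -
  have "has_pd (Inr m) (\<lambda>w. sqrt ((w (Inr 0))\<^sup>2 + (w (Inr 1))\<^sup>2)) (z (Inr m) * inverse (ylen z)) z"
    by (rule has_pd_eq, rule has_pd_sqrt, (rule has_pd_intros)+)
      (use assms in \<open>auto simp: ylen_def less_2_cases_iff\<close>)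
  then show ?thesis
    by (simp add: ylen_def[abs_def])
qed

lemma has_pd_ylen_x [has_pd_intros]: "has_pd (Inl m) ylen 0 z"
  by (simp add: has_pd_def ylen_def)

lemma has_pd_bform_y [has_pd_intros]: "has_pd (Inr m) (bform i) 0 z"
  by (cases "i = 0") (simp_all add: has_pd_def bform_def)

lemma has_pd_bform_x [has_pd_intros]:
  assumes "k < 2" shows "has_pd (Inl k) (bform i) (bform_deriv i k) z"
  unfolding bform_def[abs_def]
  by (cases "i = 0"; simp; rule has_pd_eq, (rule has_pd_intros)+;
      use assms in \<open>auto simp: bform_deriv_def less_2_cases_iff\<close>)

section \<open>First derivatives of F, P and G, and their homogeneity\<close>

definition randers_y :: "nat \<Rightarrow> (nat + nat \<Rightarrow> real) \<Rightarrow> real" where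
  "randers_y m z = z (Inr m) * inverse (ylen z) + bform m z"

definition randers_x :: "nat \<Rightarrow> (nat + nat \<Rightarrow> real) \<Rightarrow> real" where
  "randers_x k z = bform_deriv 0 k * z (Inr 0) + bform_deriv 1 k * z (Inr 1)"

definition bcross_y :: "nat \<Rightarrow> (nat + nat \<Rightarrow> real) \<Rightarrow> real" where
  "bcross_y m z = bform 0 z * rot_deriv 0 m + bform 1 z * rot_deriv 1 m"

definition proj_factor_y :: "nat \<Rightarrow> (nat + nat \<Rightarrow> real) \<Rightarrow> real" where
  "proj_factor_y m z = (1/2) * (z (Inr m) * inverse (ylen z) * (ylen z - 2 * bcross z)
      + ylen z * (z (Inr m) * inverse (ylen z) - 2 * bcross_y m z)) * inverse (randers z)
    - (1/2) * (ylen z * (ylen z - 2 * bcross z)) * (randers_y m z * (inverse (randers z) * inverse (randers z)))"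

definition randers_connection :: "nat \<Rightarrow> nat \<Rightarrow> (nat + nat \<Rightarrow> real) \<Rightarrow> real" where
  "randers_connection i m z = z (Inr m) * inverse (ylen z) * rot i z + ylen z * rot_deriv i m
    + (proj_factor_y m z * z (Inr i) + proj_factor z * (if m = i then 1 else 0))"

lemma has_pd_randers_y [has_pd_intros]:
  assumes "m < 2" "ylen z > 0" shows "has_pd (Inr m) randers (randers_y m z) z"
  unfolding randers_def[abs_def]
  by (rule has_pd_eq, (rule has_pd_intros assms)+)
    (use assms in \<open>auto simp: randers_y_def less_2_cases_iff\<close>)

lemma has_pd_randers_x [has_pd_intros]:
  assumes "k < 2" shows "has_pd (Inl k) randers (randers_x k z) z"
  unfolding randers_def[abs_def]
  by (rule has_pd_eq, (rule has_pd_intros assms)+)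
    (use assms in \<open>auto simp: randers_x_def less_2_cases_iff\<close>)

lemma has_pd_bcross_y [has_pd_intros]:
  assumes "m < 2" shows "has_pd (Inr m) bcross (bcross_y m z) z"
  unfolding bcross_def[abs_def]
  by (rule has_pd_eq, (rule has_pd_intros assms)+) (simp add: bcross_y_def)

lemma has_pd_proj_factor_y [has_pd_intros]:
  assumes "m < 2" "ylen z > 0" "randers z \<noteq> 0"
  shows "has_pd (Inr m) proj_factor (proj_factor_y m z) z"
  unfolding proj_factor_def[abs_def]
  by (rule has_pd_eq, (rule has_pd_intros assms)+) (simp add: proj_factor_y_def power2_eq_square)

lemma has_pd_randers_spray_y [has_pd_intros]:
  assumes "m < 2" "ylen z > 0" "randers z \<noteq> 0"
  shows "has_pd (Inr m) (randers_spray i) (randers_connection i m z) z"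
  unfolding randers_spray_def[abs_def]
  by (rule has_pd_eq, (rule has_pd_intros assms)+) (simp add: randers_connection_def)

lemma euler_ylen [euler_intros]:
  assumes "ylen z > 0" shows "euler 1 ylen z"
  unfolding euler_def
proof (intro exI[of _ "\<lambda>m. z (Inr m) * inverse (ylen z)"] conjI allI impI)
  show "has_pd (Inr m) ylen (z (Inr m) * inverse (ylen z)) z" if "m < 2" for m
    by (rule has_pd_ylen_y[OF that assms])
  have "(\<Sum>m<2. z (Inr m) * (z (Inr m) * inverse (ylen z))) = (ylen z)\<^sup>2 * inverse (ylen z)"
    unfolding ylen_power2 sum_lessThan_2 by (simp add: power2_eq_square algebra_simps)
  then show "(\<Sum>m<2. z (Inr m) * (z (Inr m) * inverse (ylen z))) = 1 * ylen z"
    using assms by (simp add: power2_eq_square)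
qed

lemma euler_bform [euler_intros]: "euler 0 (bform i) z"
  unfolding euler_def
  by (intro exI[of _ "\<lambda>_. 0"]) (auto intro: has_pd_bform_y)

lemma euler_randers [euler_intros]:
  assumes "ylen z > 0" shows "euler 1 randers z"
  unfolding randers_def[abs_def]
  by (rule euler_cong, (rule euler_intros | simp add: assms assms(1)[THEN less_imp_neq, THEN not_sym])+)

lemma euler_bcross [euler_intros]: "euler 1 bcross z"
  unfolding bcross_def[abs_def]
  by (rule euler_cong, (rule euler_intros | simp)+)

lemma euler_proj_factor [euler_intros]:
  assumes "ylen z > 0" "randers z \<noteq> 0" shows "euler 1 proj_factor z"
  unfolding proj_factor_def[abs_def]
  by (rule euler_cong, (rule euler_intros | simp add: assms assms(1)[THEN less_imp_neq, THEN not_sym])+)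

lemma euler_randers_spray:
  assumes "ylen z > 0" "randers z \<noteq> 0" "i < 2" shows "euler 2 (randers_spray i) z"
  unfolding randers_spray_def[abs_def]
  by (rule euler_cong, (rule euler_intros | simp add: assms assms(1)[THEN less_imp_neq, THEN not_sym])+)

lemma euler_randers_y [euler_intros]:
  assumes "ylen z > 0" "m < 2" shows "euler 0 (randers_y m) z"
  unfolding randers_y_def[abs_def]
  by (rule euler_cong, (rule euler_intros | simp add: assms assms(1)[THEN less_imp_neq, THEN not_sym])+)

lemma euler_bcross_y [euler_intros]: "euler 0 (bcross_y m) z"
  unfolding bcross_y_def[abs_def]
  by (rule euler_cong, (rule euler_intros | simp)+)

lemma euler_proj_factor_y [euler_intros]:
  assumes "ylen z > 0" "randers z \<noteq> 0" "m < 2" shows "euler 0 (proj_factor_y m) z"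
  unfolding proj_factor_y_def[abs_def]
  by (rule euler_cong, (rule euler_intros | simp add: assms assms(1)[THEN less_imp_neq, THEN not_sym])+)

lemma euler_randers_connection:
  assumes "ylen z > 0" "randers z \<noteq> 0" "i < 2" "m < 2" shows "euler 1 (randers_connection i m) z"
  unfolding randers_connection_def[abs_def]
  by (rule euler_cong, (rule euler_intros | simp add: assms assms(1)[THEN less_imp_neq, THEN not_sym])+)

text \<open>The Jacobian of y / |y| is symmetric and annihilates y, hence is a multiple of h h in
  dimension two; concretely |y|^2 delta - y y = h h. This is the source of the factors h in the
  Hessian of F.\<close>

lemma has_pd_unit_y:
  assumes "m < 2" "l < 2" "ylen z > 0"
  shows "has_pd (Inr m) (\<lambda>w. w (Inr l) * inverse (ylen w)) (inverse (ylen z) ^ 3 * (rot l z * rot m z)) z"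
proof -
  let ?q = "inverse (ylen z)"
  have q: "?q = ?q ^ 3 * ((z (Inr 0))\<^sup>2 + (z (Inr 1))\<^sup>2)"
    unfolding ylen_power2[symmetric] using assms(3) by (simp add: field_simps power2_eq_square power3_eq_cube)
  have "(if m = l then 1 else 0) * ?q + z (Inr l) * (- (z (Inr m) * ?q) * ?q\<^sup>2)
      = (if m = l then 1 else 0) * (?q ^ 3 * ((z (Inr 0))\<^sup>2 + (z (Inr 1))\<^sup>2)) - ?q ^ 3 * (z (Inr l) * z (Inr m))"
    by (subst q[symmetric]) (simp add: power2_eq_square power3_eq_cube)
  also have "\<dots> = ?q ^ 3 * (rot l z * rot m z)"
    using assms(1,2) by (auto simp: less_2_cases_iff rot_def power2_eq_square algebra_simps)
  finally show ?thesis
    by - (rule has_pd_eq, (rule has_pd_intros assms less_imp_neq[THEN not_sym])+, simp)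
qed

lemma has_pd_randers_y_y [has_pd_intros]:
  assumes "m < 2" "l < 2" "ylen z > 0"
  shows "has_pd (Inr m) (randers_y l) (inverse (ylen z) ^ 3 * (rot l z * rot m z)) z"
  unfolding randers_y_def[abs_def]
  by (rule has_pd_eq, (rule has_pd_unit_y has_pd_add has_pd_bform_y assms)+) simp

lemma has_pd_randers_y_x [has_pd_intros]:
  assumes "k < 2" "ylen z > 0"
  shows "has_pd (Inl k) (randers_y l) (bform_deriv l k) z"
  unfolding randers_y_def[abs_def]
  by (rule has_pd_eq, (rule has_pd_intros assms less_imp_neq[THEN not_sym])+) simp

lemma randers_y_y:
  assumes "ylen z > 0"
  shows "randers_y 0 z * z (Inr 0) + randers_y 1 z * z (Inr 1) = randers z"
proof -
  have "(\<Sum>m<2. z (Inr m) * randers_y m z) = 1 * randers z"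
    by (intro euler_has_pd euler_randers has_pd_randers_y assms)
  then show ?thesis
    by (simp add: sum_lessThan_2 mult.commute)
qed

lemma randers_y_rot: "randers_y 0 z * rot 0 z + randers_y 1 z * rot 1 z = bcross z"
  by (simp add: randers_y_def bcross_def rot_def algebra_simps)

text \<open>The coframe F_y, h diagonalises the fundamental tensor, and these are the components of
  G in it. The first identity is what determines P: the left side equals |y| b(h) + P F.\<close>

lemma randers_spray_eq:
  assumes "ylen z > 0" "randers z > 0"
  shows "randers_y 0 z * randers_spray 0 z + randers_y 1 z * randers_spray 1 z = (ylen z)\<^sup>2 / 2"
    and "rot 0 z * randers_spray 0 z + rot 1 z * randers_spray 1 z = (ylen z) ^ 3"
proof -
  have "randers_y 0 z * randers_spray 0 z + randers_y 1 z * randers_spray 1 z =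
      ylen z * (randers_y 0 z * rot 0 z + randers_y 1 z * rot 1 z) +
      proj_factor z * (randers_y 0 z * z (Inr 0) + randers_y 1 z * z (Inr 1))"
    by (simp add: randers_spray_def algebra_simps)
  also have "\<dots> = (ylen z)\<^sup>2 / 2"
    unfolding randers_y_y[OF assms(1)] randers_y_rot using assms(2)
    by (simp add: proj_factor_def power2_eq_square field_simps)
  finally show "randers_y 0 z * randers_spray 0 z + randers_y 1 z * randers_spray 1 z = (ylen z)\<^sup>2 / 2" .
  have "rot 0 z * randers_spray 0 z + rot 1 z * randers_spray 1 z =
      ylen z * ((z (Inr 0))\<^sup>2 + (z (Inr 1))\<^sup>2)"
    by (simp add: randers_spray_def rot_def power2_eq_square algebra_simps)
  then show "rot 0 z * randers_spray 0 z + rot 1 z * randers_spray 1 z = (ylen z) ^ 3"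
    unfolding ylen_power2[symmetric] by (simp add: power2_eq_square power3_eq_cube)
qed

text \<open>Since h is y after a quarter turn, the determinant of the coframe F_y, h is y^m F_{.m},
  which is F by Euler. So the coframe is independent where F > 0.\<close>

lemma randers_y_cross_rot:
  "ylen z > 0 \<Longrightarrow> randers_y 0 z * rot 1 z - randers_y 1 z * rot 0 z = randers z"
  using randers_y_y[of z] by (simp add: rot_def)

lemma Inr_mem: "m < 2 \<Longrightarrow> Inr m \<in> {..<2::nat} <+> {..<2::nat}"
  and Inl_mem: "m < 2 \<Longrightarrow> Inl m \<in> {..<2::nat} <+> {..<2::nat}"
  by auto

section \<open>Fundamental tensor and spray of the Randers metric\<close>

context
  fixes L :: "(nat + nat \<Rightarrow> real) \<Rightarrow> real"
  assumes L: "\<And>w. w \<in> disc_slit \<Longrightarrow> L w = randers w"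
begin

text \<open>\<open>L\<close> stands for the local representation of the metric, which is computed
  only on \<open>disc_slit\<close>; hence all derivatives are taken through
  \<open>pd_eqI\<close>.\<close>

lemma pdy_square:
  assumes "l < 2" "w \<in> disc_slit"
  shows "pdy l (\<lambda>w. (L w)\<^sup>2) w = 2 * (randers w * randers_y l w)"
proof (rule pd_eqI[OF coord_open_disc_slit Inr_mem[OF assms(1)] assms(2)])
  show "has_pd (Inr l) (\<lambda>w. (randers w)\<^sup>2) (2 * (randers w * randers_y l w)) w"
    by (rule has_pd_eq, (rule has_pd_intros assms ylen_pos)+) simp
qed (simp add: L)

lemma pdx_square:
  assumes "l < 2" "w \<in> disc_slit"
  shows "pdx l (\<lambda>w. (L w)\<^sup>2) w = 2 * (randers w * randers_x l w)"
proof (rule pd_eqI[OF coord_open_disc_slit Inl_mem[OF assms(1)] assms(2)])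
  show "has_pd (Inl l) (\<lambda>w. (randers w)\<^sup>2) (2 * (randers w * randers_x l w)) w"
    by (rule has_pd_eq, (rule has_pd_intros assms ylen_pos)+) simp
qed (simp add: L)

lemma pdx_pdy_square:
  assumes "k < 2" "l < 2" "w \<in> disc_slit"
  shows "pdx k (pdy l (\<lambda>w. (L w)\<^sup>2)) w =
    2 * (randers_x k w * randers_y l w + randers w * bform_deriv l k)"
proof (rule pd_eqI[OF coord_open_disc_slit Inl_mem[OF assms(1)] assms(3)])
  show "has_pd (Inl k) (\<lambda>w. 2 * (randers w * randers_y l w))
     (2 * (randers_x k w * randers_y l w + randers w * bform_deriv l k)) w"
    by (rule has_pd_eq, (rule has_pd_intros assms ylen_pos)+) simp
qed (simp add: pdy_square assms)

text \<open>This is g = F_y F_y + F F_yy. As b(y) is linear in y, the Hessian F_yy is that of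
  |y|.\<close>

lemma fund_tensor_randers:
  assumes "i < 2" "j < 2" "w \<in> disc_slit"
  shows "fund_tensor L i j w = randers_y i w * randers_y j w
    + randers w * inverse (ylen w) ^ 3 * (rot i w * rot j w)"
proof -
  have "pdy i (pdy j (\<lambda>w. (L w)\<^sup>2)) w = 2 * (randers_y i w * randers_y j w
    + randers w * (inverse (ylen w) ^ 3 * (rot j w * rot i w)))"
  proof (rule pd_eqI[OF coord_open_disc_slit Inr_mem[OF assms(1)] assms(3)])
    show "has_pd (Inr i) (\<lambda>w. 2 * (randers w * randers_y j w))
       (2 * (randers_y i w * randers_y j w
    + randers w * (inverse (ylen w) ^ 3 * (rot j w * rot i w)))) w"
      by (rule has_pd_eq, (rule has_pd_intros assms ylen_pos)+) simp
  qed (simp add: pdy_square assms)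
  then show ?thesis
    by (simp add: fund_tensor_def)
qed

text \<open>In the coframe F_y, h the form is a sum of two squares with positive weights, and the
  coframe is independent.\<close>

lemma fund_tensor_pos:
  assumes z: "z \<in> disc_slit" and u: "u \<in> coord_space {..<2}" "u \<noteq> (\<lambda>_. 0)"
  shows "(\<Sum>i<2. \<Sum>j<2. fund_tensor L i j z * u i * u j) > 0"
proof -
  define a where "a = randers_y 0 z * u 0 + randers_y 1 z * u 1"
  define b where "b = rot 0 z * u 0 + rot 1 z * u 1"
  define c where "c = randers z * inverse (ylen z) ^ 3"
  have "c > 0"
    using randers_pos[OF z] ylen_pos[OF z] by (simp add: c_def)
  have eq: "(\<Sum>i<2. \<Sum>j<2. fund_tensor L i j z * u i * u j) = a\<^sup>2 + c * b\<^sup>2"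
    by (simp add: sum_lessThan_2 fund_tensor_randers z a_def b_def c_def power2_eq_square algebra_simps)
  have "a \<noteq> 0 \<or> b \<noteq> 0"
  proof (rule ccontr)
    assume "\<not> (a \<noteq> 0 \<or> b \<noteq> 0)"
    then have ab: "a = 0" "b = 0" by auto
    \<comment> \<open>Cramer's rule recovers u from its values under F_y and h; the determinant is
      F.\<close>
    have "randers z * u 0 = a * rot 1 z - b * randers_y 1 z"
      "randers z * u 1 = b * randers_y 0 z - a * rot 0 z"
      unfolding randers_y_cross_rot[OF ylen_pos[OF z], symmetric]
      by (simp_all add: a_def b_def algebra_simps)
    then have "u 0 = 0" "u 1 = 0"
      using ab randers_pos[OF z] by simp_all
    then have "u i = 0" for i
      using u(1) by (cases "i < 2") (auto simp: coord_space_def less_2_cases_iff)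
    then show False using u(2) by auto
  qed
  then show ?thesis
    unfolding eq using \<open>c > 0\<close> by (auto intro: add_pos_nonneg add_nonneg_pos)
qed

lemma spray_randers:
  assumes i: "i < 2" and z: "z \<in> disc_slit"
  shows "spray 2 L i z = randers_spray i z"
proof (rule spray_2_eqI)
  note pos = ylen_pos[OF z] randers_pos[OF z]
  let ?c = "randers z * inverse (ylen z) ^ 3"
  \<comment> \<open>Product of the diagonal weights 1 and \<open>?c\<close>, times the square of the
    coframe determinant.\<close>
  have "fund_tensor L 0 0 z * fund_tensor L 1 1 z - fund_tensor L 0 1 z * fund_tensor L 1 0 z
      = ?c * (randers_y 0 z * rot 1 z - randers_y 1 z * rot 0 z)\<^sup>2"
    by (simp add: fund_tensor_randers z power2_eq_square algebra_simps)
  then show "fund_tensor L 0 0 z * fund_tensor L 1 1 z - fund_tensor L 0 1 z * fund_tensor L 1 0 z \<noteq> 0"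
    unfolding randers_y_cross_rot[OF pos(1)] using pos by simp
  fix l :: nat assume l: "l < 2"
  have "(\<Sum>m<2. fund_tensor L l m z * randers_spray m z)
      = randers_y l z * (randers_y 0 z * randers_spray 0 z + randers_y 1 z * randers_spray 1 z)
        + ?c * (rot l z * (rot 0 z * randers_spray 0 z + rot 1 z * randers_spray 1 z))"
    by (simp add: sum_lessThan_2 fund_tensor_randers z l algebra_simps)
  also have "\<dots> = randers_y l z * ((ylen z)\<^sup>2 / 2) + randers z * rot l z"
    unfolding randers_spray_eq[OF pos] using pos by (simp add: power_inverse)
  \<comment> \<open>The symmetric part of the matrix of derivatives of b is the identity, so y^k
    F_{x^k} = |y|^2. Its antisymmetric part gives (b_{l,k} - b_{k,l}) y^k = 2 h_l.\<close>
  also have "\<dots> = ((\<Sum>k<2. 2 * (randers_x k z * randers_y l z + randers z * bform_deriv l k) * z (Inr k))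
      - 2 * (randers z * randers_x l z)) / 4"
    unfolding ylen_power2 using l
    by (auto simp: sum_lessThan_2 less_2_cases_iff randers_x_def bform_deriv_def rot_def
        power2_eq_square field_simps)
  also have "\<dots> = ((\<Sum>k<2. pdx k (pdy l (\<lambda>w. (L w)\<^sup>2)) z * z (Inr k))
      - pdx l (\<lambda>w. (L w)\<^sup>2) z) / 4"
    by (simp add: pdx_pdy_square pdx_square z l)
  finally show "(\<Sum>m<2. fund_tensor L l m z * randers_spray m z) =
      ((\<Sum>k<2. pdx k (pdy l (\<lambda>w. (L w)\<^sup>2)) z * z (Inr k)) - pdx l (\<lambda>w. (L w)\<^sup>2) z) / 4" .
qed (rule i)

lemma pdy_spray_randers:
  assumes "i < 2" "m < 2" "z \<in> disc_slit"
  shows "pdy m (spray 2 L i) z = randers_connection i m z"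
  by (rule pd_eqI[OF coord_open_disc_slit Inr_mem[OF assms(2)] assms(3) spray_randers[OF assms(1)]])
    (use assms ylen_pos randers_pos[OF assms(3)] in \<open>auto intro!: has_pd_randers_spray_y\<close>)

end

text \<open>The part |y| h has no divergence, since h is orthogonal to y and
  \<open>rot_deriv\<close> is traceless. The part P y contributes 2 P, and by Euler's identity
  another P.\<close>

lemma randers_connection_trace:
  assumes "z \<in> disc_slit"
  shows "randers_connection 0 0 z + randers_connection 1 1 z = 3 * proj_factor z"
proof -
  have "randers z \<noteq> 0" using randers_pos[OF assms] by simp
  then have "(\<Sum>m<2. z (Inr m) * proj_factor_y m z) = 1 * proj_factor z"
    using ylen_pos[OF assms] by (intro euler_has_pd euler_proj_factor has_pd_proj_factor_y) auto
  then show ?thesis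
    by (simp add: randers_connection_def sum_lessThan_2 rot_def rot_deriv_def algebra_simps)
qed

section \<open>Smoothness on the slit tangent bundle of the disc\<close>

lemma smooth_fun_on_power:
  assumes "coord_open I W" "smooth_fun_on I W f"
  shows "smooth_fun_on I W (\<lambda>w. f w ^ n)"
  by (induction n) (auto intro: smooth_fun_on_const smooth_fun_on_mult assms)

lemmas smooth_disc_intros =
  smooth_fun_on_const[OF coord_open_disc_slit] smooth_fun_on_coord[OF coord_open_disc_slit]
  smooth_fun_on_add[OF coord_open_disc_slit] smooth_fun_on_diff[OF coord_open_disc_slit]
  smooth_fun_on_mult[OF coord_open_disc_slit] smooth_fun_on_power[OF coord_open_disc_slit]
  smooth_fun_on_inverse[OF coord_open_disc_slit] smooth_fun_on_sqrt[OF coord_open_disc_slit]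

abbreviation smooth_disc :: "((nat + nat \<Rightarrow> real) \<Rightarrow> real) \<Rightarrow> bool" where
  "smooth_disc \<equiv> smooth_fun_on ({..<2} <+> {..<2}) disc_slit"

lemma smooth_ylen: "smooth_disc ylen"
  unfolding ylen_def[abs_def] by (intro smooth_disc_intros disc_slitD(2))

lemma smooth_rot: "smooth_disc (rot i)"
proof -
  have "smooth_disc (\<lambda>w. (-1) * w (Inr 1))" "smooth_disc (\<lambda>w. w (Inr 0))"
    by (intro smooth_disc_intros)+
  then show ?thesis
    unfolding rot_def[abs_def] by (cases "i = 0") simp_all
qed

lemma smooth_bform: "smooth_disc (bform i)"
  unfolding bform_def[abs_def] by (cases "i = 0") (simp_all, (intro smooth_disc_intros)+)

lemma smooth_randers: "smooth_disc randers"
  unfolding randers_def[abs_def] by (intro smooth_disc_intros smooth_ylen smooth_bform)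

lemma smooth_inverse_ylen: "smooth_disc (\<lambda>w. inverse (ylen w))"
  by (intro smooth_disc_intros smooth_ylen) (use ylen_pos in force)

lemma smooth_inverse_randers: "smooth_disc (\<lambda>w. inverse (randers w))"
  by (intro smooth_disc_intros smooth_randers) (use randers_pos in force)

lemma smooth_proj_factor: "smooth_disc proj_factor"
  unfolding proj_factor_def[abs_def] bcross_def
  by (intro smooth_disc_intros smooth_ylen smooth_bform smooth_rot smooth_inverse_randers)

lemma smooth_randers_connection: "smooth_disc (randers_connection i m)"
  unfolding randers_connection_def[abs_def] proj_factor_y_def randers_y_def bcross_y_def bcross_def
  by (intro smooth_disc_intros smooth_ylen smooth_bform smooth_rot smooth_inverse_ylen
      smooth_inverse_randers smooth_proj_factor)

text \<open>The covector to be constructed contains the transported coefficient of D~ and has to be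
  smooth.\<close>

lemma smooth_transport:
  assumes "smooth_disc t" shows "smooth_disc (transport randers_connection t)"
  unfolding transport_def[abs_def] sum_lessThan_2
  by (intro smooth_disc_intros smooth_randers_connection smooth_fun_on_pd assms Inl_mem Inr_mem) auto

section \<open>The Douglas tensor and its first two derivatives along y\<close>

definition douglas_coeff :: "(nat + nat \<Rightarrow> real) \<Rightarrow> real" where
  "douglas_coeff z = (-3) * inverse (ylen z) ^ 5"

definition Dtilde_coeff :: "(nat + nat \<Rightarrow> real) \<Rightarrow> real" where
  "Dtilde_coeff z = douglas_coeff z * proj_factor z"

lemma smooth_douglas_coeff: "smooth_disc douglas_coeff"
  unfolding douglas_coeff_def[abs_def] by (intro smooth_disc_intros smooth_inverse_ylen)

lemma smooth_Dtilde_coeff: "smooth_disc Dtilde_coeff"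
  unfolding Dtilde_coeff_def[abs_def]
  by (intro smooth_disc_intros smooth_douglas_coeff smooth_proj_factor)

lemma Dtilde_coeff_nonzero: "z \<in> disc_slit \<Longrightarrow> Dtilde_coeff z \<noteq> 0"
  using proj_factor_pos[of z] ylen_pos[of z] by (simp add: Dtilde_coeff_def douglas_coeff_def)

text \<open>Here q stands for 1/|y|. The left side is the outcome of the product rule in the third
  derivative of |y| h^i, and the hypothesis brings all its terms to the common power q^5.\<close>

lemma douglas_third_derivative:
  fixes z :: "nat + nat \<Rightarrow> real"
  assumes "q ^ 3 = q ^ 5 * ((z (Inr 0))\<^sup>2 + (z (Inr 1))\<^sup>2)" "j < 2" "i < 2" "k < 2" "l < 2"
  shows "- 3 * (z (Inr j) * q ^ 5) * (rot l z * rot k z * rot i z)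
    + q ^ 3 * ((rot_deriv l j * rot k z + rot l z * rot_deriv k j) * rot i z + rot l z * rot k z * rot_deriv i j)
    + q ^ 3 * (rot l z * rot j z) * rot_deriv i k + q ^ 3 * (rot k z * rot j z) * rot_deriv i l
    = - 3 * q ^ 5 * (z (Inr i) * (rot j z * (rot k z * rot l z)))"
proof -
  \<comment> \<open>An opaque factor in place of \<open>q ^ 5\<close>, so that a polynomial identity
    in y remains.\<close>
  define Q where "Q = q ^ 5"
  show ?thesis
    unfolding assms(1) Q_def[symmetric] using assms(2-)[THEN less_2_cases]
    by (elim disjE; simp add: rot_def rot_deriv_def power2_eq_square algebra_simps)
qed

text \<open>|y| h^i is the spray without its trace part. It is differentiated by y^l here, then by
  y^k and y^j, the order of nesting in \<open>douglas_tensor\<close>.\<close>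

lemma has_pd_ylen_rot:
  assumes "l < 2" "ylen w > 0"
  shows "has_pd (Inr l) (\<lambda>w. ylen w * rot i w) (w (Inr l) * inverse (ylen w) * rot i w + ylen w * rot_deriv i l) w"
  by (rule has_pd_eq, (rule has_pd_intros assms)+) simp

lemma has_pd_ylen_rot_2:
  assumes "l < 2" "k < 2" "ylen w > 0"
  shows "has_pd (Inr k) (\<lambda>w. w (Inr l) * inverse (ylen w) * rot i w + ylen w * rot_deriv i l)
    (inverse (ylen w) ^ 3 * (rot l w * rot k w * rot i w) + w (Inr l) * inverse (ylen w) * rot_deriv i k
      + w (Inr k) * inverse (ylen w) * rot_deriv i l) w"
  \<comment> \<open>The instances of \<open>has_pd_mult\<close> keep y^l / |y| in one piece, so that
    \<open>has_pd_unit_y\<close> applies to it.\<close>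
  by (rule has_pd_eq,
      (rule has_pd_unit_y has_pd_add has_pd_mult[where f = "\<lambda>w. w (Inr l) * inverse (ylen w)"]
        has_pd_mult[where f = ylen] has_pd_ylen_y has_pd_rot_y has_pd_const assms)+)
    simp

lemma has_pd_ylen_rot_3:
  assumes "l < 2" "k < 2" "j < 2" "i < 2" "ylen z > 0"
  shows "has_pd (Inr j) (\<lambda>w. inverse (ylen w) ^ 3 * (rot l w * rot k w * rot i w)
      + w (Inr l) * inverse (ylen w) * rot_deriv i k + w (Inr k) * inverse (ylen w) * rot_deriv i l)
    (douglas_coeff z * (z (Inr i) * (rot j z * (rot k z * rot l z)))) z"
proof -
  let ?q = "inverse (ylen z)"
  have nz: "ylen z \<noteq> 0" using assms by simp
  have "?q ^ 3 = ?q ^ 5 * (ylen z)\<^sup>2"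
    using nz by (simp add: field_simps power_numeral_reduce)
  then have q: "?q ^ 3 = ?q ^ 5 * ((z (Inr 0))\<^sup>2 + (z (Inr 1))\<^sup>2)"
    by (simp add: ylen_power2)
  have 1: "has_pd (Inr j) (\<lambda>w. inverse (ylen w) ^ 3 * (rot l w * rot k w * rot i w))
    (- 3 * (z (Inr j) * ?q ^ 5) * (rot l z * rot k z * rot i z)
    + ?q ^ 3 * ((rot_deriv l j * rot k z + rot l z * rot_deriv k j) * rot i z + rot l z * rot k z * rot_deriv i j)) z"
    by (rule has_pd_eq, (rule has_pd_intros assms nz)+) (simp add: power_numeral_reduce)
  have 2: "has_pd (Inr j) (\<lambda>w. w (Inr a) * inverse (ylen w) * c) (?q ^ 3 * (rot a z * rot j z) * c) z"
    if "a < 2" for a c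
    by (rule has_pd_eq, (rule has_pd_unit_y has_pd_const that assms
      has_pd_mult[where f = "\<lambda>w. w (Inr a) * inverse (ylen w)"])+) simp
  show ?thesis
    unfolding douglas_coeff_def douglas_third_derivative[OF q assms(3,4,2,1), symmetric]
    by (intro has_pd_add 1 2 assms)
qed

text \<open>The coefficient d depends on |y| alone, with degree -5, and y^m N^r_m = 2 G^r has radial
  part 2 P y^r. So the derivative along the spray yields 10 P d and the three traces yield - 9 P
  d.\<close>

lemma transport_douglas_coeff:
  assumes "z \<in> disc_slit"
  shows "transport randers_connection douglas_coeff z = Dtilde_coeff z"
proof -
  let ?q = "inverse (ylen z)"
  have pos: "ylen z > 0" "ylen z \<noteq> 0" "randers z \<noteq> 0"
    using ylen_pos[OF assms] randers_pos[OF assms] by auto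
  have x: "pdx m douglas_coeff z = 0" for m
    unfolding douglas_coeff_def[abs_def]
    by (rule has_pd_imp_pd, rule has_pd_eq, (rule has_pd_intros pos)+) simp
  have y: "pdy m douglas_coeff z = 15 * (z (Inr m) * ?q ^ 7)" if "m < 2" for m
    unfolding douglas_coeff_def[abs_def]
    by (rule has_pd_imp_pd, rule has_pd_eq, (rule has_pd_intros pos that)+) (simp add: power_numeral_reduce)
  have c: "(\<Sum>m<2. z (Inr m) * randers_connection r m z) = 2 * randers_spray r z" if "r < 2" for r
    using pos that by (intro euler_has_pd euler_randers_spray has_pd_randers_spray_y) auto
  have G: "randers_spray 0 z * z (Inr 0) + randers_spray 1 z * z (Inr 1) = proj_factor z * (ylen z)\<^sup>2"
    unfolding ylen_power2 by (simp add: randers_spray_def rot_def power2_eq_square algebra_simps)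
  have "(\<Sum>r<2. 2 * randers_spray r z * pdy r douglas_coeff z) =
      30 * ?q ^ 7 * (randers_spray 0 z * z (Inr 0) + randers_spray 1 z * z (Inr 1))"
    by (simp add: sum_lessThan_2 y algebra_simps)
  also have "\<dots> = 30 * ?q ^ 7 * (proj_factor z * (ylen z)\<^sup>2)"
    by (simp only: G)
  also have "\<dots> = 30 * ?q ^ 5 * proj_factor z"
    using pos by (simp add: field_simps power_numeral_reduce)
  finally show ?thesis
    by (simp add: transport_def x c randers_connection_trace[OF assms, simplified] Dtilde_coeff_def douglas_coeff_def)
qed

context
  fixes L :: "(nat + nat \<Rightarrow> real) \<Rightarrow> real"
  assumes L: "\<And>w. w \<in> disc_slit \<Longrightarrow> L w = randers w"
begin

lemma douglas_tensor_randers: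
  assumes jikl: "j < 2" "i < 2" "k < 2" "l < 2" and "z \<in> disc_slit"
  shows "douglas_tensor 2 L j i k l z = douglas_coeff z * (z (Inr i) * (rot j z * (rot k z * rot l z)))"
proof -
  let ?\<Pi> = "\<lambda>w. spray 2 L i w - 1 / (real 2 + 1) * (\<Sum>m<2. pdy m (spray 2 L m) w) * w (Inr i)"
  \<comment> \<open>The trace is 3 P and n + 1 = 3, so precisely the term P y^i of the spray is
    removed.\<close>
  have 0: "?\<Pi> w = ylen w * rot i w" if "w \<in> disc_slit" for w
  proof -
    have "(\<Sum>m<2. pdy m (spray 2 L m) w) = 3 * proj_factor w"
      using that randers_connection_trace[OF that]
      by (simp add: sum_lessThan_2 pdy_spray_randers[OF L])
    then show ?thesis
      using that jikl by (simp add: spray_randers[OF L] randers_spray_def)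
  qed
  have 1: "pdy l ?\<Pi> w = w (Inr l) * inverse (ylen w) * rot i w + ylen w * rot_deriv i l"
    if "w \<in> disc_slit" for w
    by (rule pd_eqI[OF coord_open_disc_slit Inr_mem[OF jikl(4)] that 0])
      (assumption, rule has_pd_ylen_rot[OF jikl(4) ylen_pos[OF that]])
  have 2: "pdy k (pdy l ?\<Pi>) w = inverse (ylen w) ^ 3 * (rot l w * rot k w * rot i w)
      + w (Inr l) * inverse (ylen w) * rot_deriv i k + w (Inr k) * inverse (ylen w) * rot_deriv i l"
    if "w \<in> disc_slit" for w
    by (rule pd_eqI[OF coord_open_disc_slit Inr_mem[OF jikl(3)] that 1])
      (assumption, rule has_pd_ylen_rot_2[OF jikl(4,3) ylen_pos[OF that]])
  show ?thesis
    unfolding douglas_tensor_def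
    by (rule pd_eqI[OF coord_open_disc_slit Inr_mem[OF jikl(1)] \<open>z \<in> disc_slit\<close> 2])
      (assumption, rule has_pd_ylen_rot_3[OF jikl(4,3,1,2) ylen_pos[OF \<open>z \<in> disc_slit\<close>]])
qed

lemma hcov0_randers:
  assumes "\<And>j i k l w. j < 2 \<Longrightarrow> i < 2 \<Longrightarrow> k < 2 \<Longrightarrow> l < 2 \<Longrightarrow> w \<in> disc_slit \<Longrightarrow>
      T j i k l w = t w * (w (Inr i) * (rot j w * (rot k w * rot l w)))"
    and "smooth_disc t" "j < 2" "i < 2" "k < 2" "l < 2" "z \<in> disc_slit"
  shows "hcov0 2 L T j i k l z =
    transport randers_connection t z * (z (Inr i) * (rot j z * (rot k z * rot l z)))"
proof (rule hcov0_2_rot_multiple[OF coord_open_disc_slit \<open>z \<in> disc_slit\<close> pdy_spray_randers[OF L]])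
  have "ylen z > 0" "randers z \<noteq> 0"
    using ylen_pos[OF \<open>z \<in> disc_slit\<close>] randers_pos[OF \<open>z \<in> disc_slit\<close>] by auto
  then show "euler 1 (randers_connection i m) z" if "i < 2" "m < 2" for i m
    using that by (rule euler_randers_connection)
qed (use assms in auto)

lemma Dtilde_randers:
  assumes "j < 2" "i < 2" "k < 2" "l < 2" "z \<in> disc_slit"
  shows "Dtilde 2 L j i k l z = Dtilde_coeff z * (z (Inr i) * (rot j z * (rot k z * rot l z)))"
  unfolding Dtilde_def transport_douglas_coeff[OF assms(5), symmetric]
  by (rule hcov0_randers[OF douglas_tensor_randers smooth_douglas_coeff assms])

lemma hcov0_Dtilde_randers:
  assumes "j < 2" "i < 2" "k < 2" "l < 2" "z \<in> disc_slit"
  shows "hcov0 2 L (Dtilde 2 L) j i k l z =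
    transport randers_connection Dtilde_coeff z * (z (Inr i) * (rot j z * (rot k z * rot l z)))"
  by (rule hcov0_randers[OF Dtilde_randers smooth_Dtilde_coeff assms])

end

section \<open>The disc as a manifold with a single chart\<close>

lemma disc_chart_simps [simp]: "chart_dom disc_chart = disc" "chart_map disc_chart p = p"
  by (simp_all add: disc_chart_def)

lemma chart_map_disc [simp]: "chart_map disc_chart ` S = S"
  by (simp add: disc_chart_def)

lemma transition_disc: "x \<in> disc \<Longrightarrow> transition disc_chart disc_chart x = x"
  using f_inv_into_f[of x "chart_map disc_chart" disc] by (simp add: transition_def)

lemma coord_open_disc: "coord_open {..<2} disc"
  by (rule coord_open_openin[OF openin_disc])

lemma second_countable_euclidean:
  "second_countable (euclidean :: 'a::second_countable_topology topology)"
proof -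
  obtain B :: "'a set set" where "countable B" "\<And>C. C \<in> B \<Longrightarrow> open C"
    "\<And>S. open S \<Longrightarrow> \<exists>U. U \<subseteq> B \<and> S = \<Union>U"
    using univ_second_countable by blast
  then show ?thesis
    unfolding second_countable_def open_openin[symmetric] by (intro exI[of _ B]) (metis Sup_upper UnionE subset_iff)
qed

lemma smooth_manifold_disc: "smooth_manifold 2 (top_of_set disc) {disc_chart}"
proof -
  have "chart_map disc_chart = (\<lambda>p. p)"
    by auto
  then have "homeomorphic_map (top_of_set disc) (top_of_set disc) (chart_map disc_chart)"
    using homeomorphic_map_id[of "top_of_set disc" "top_of_set disc"] by (simp add: id_def)
  moreover have "smooth_fun_on {..<2} disc (\<lambda>x. transition disc_chart disc_chart x i)" for i
    by (rule smooth_fun_on_cong[OF coord_open_disc _ smooth_fun_on_coord[OF coord_open_disc, of i]])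
      (simp add: transition_disc)
  ultimately show ?thesis
    unfolding smooth_manifold_def
    by (auto simp: openin_disc Hausdorff_space_subtopology
        second_countable_subtopology[OF second_countable_euclidean]
        subtopology_subtopology)
qed

lemma jacobian_disc:
  assumes "p \<in> disc" "j < 2"
  shows "jacobian disc_chart disc_chart p i j = (if j = i then 1 else 0)"
  unfolding jacobian_def
  by (rule pd_eqI[OF coord_open_disc, where g = "\<lambda>x. x i"])
    (use assms in \<open>simp_all only: transition_disc lessThan_iff disc_chart_simps has_pd_coord\<close>)

lemma tangent_bundle_disc:
  "tangent_bundle 2 {disc_chart} = {(p, v). p \<in> disc \<and> v disc_chart \<in> coord_space {..<2} \<and>
     (\<forall>c. c \<noteq> disc_chart \<longrightarrow> v c = (\<lambda>_. 0))}"
  unfolding tangent_bundle_def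
  by (auto simp: jacobian_disc sum_lessThan_2 less_2_cases_iff)

text \<open>The function factors through \<open>tangent_coords\<close>, so it suffices that the
  point chosen by \<open>inv_into\<close> has coordinates \<open>z\<close>, that is, that
  \<open>z\<close> lies in the image.\<close>

lemma local_rep_disc:
  assumes "z \<in> disc_slit"
  shows "local_rep 2 {disc_chart} disc_chart (\<lambda>q. g (tangent_coords disc_chart q)) z = g z"
proof -
  obtain x y where xy: "z = case_sum x y" "x \<in> disc" "y \<in> coord_space {..<2}"
    using assms by (auto simp: slit_dom_def)
  let ?S = "{q \<in> tangent_bundle 2 {disc_chart}. fst q \<in> chart_dom disc_chart}"
  \<comment> \<open>The tangent vector with these coordinates; components in all other charts are 0
    by convention.\<close>
  let ?q = "(x, \<lambda>c. if c = disc_chart then y else (\<lambda>_. 0))"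
  have "?q \<in> ?S" "z = tangent_coords disc_chart ?q"
    using xy by (auto simp: tangent_bundle_disc tangent_coords_def)
  then have "z \<in> tangent_coords disc_chart ` ?S"
    by blast
  then show ?thesis
    unfolding local_rep_def by (simp only: f_inv_into_f)
qed

section \<open>The Randers metric on the tangent bundle of the disc\<close>

definition randers_metric :: "(nat \<Rightarrow> real) tangent \<Rightarrow> real" where
  "randers_metric q = randers (tangent_coords disc_chart q)"

lemma local_rep_randers_metric:
  "z \<in> disc_slit \<Longrightarrow> local_rep 2 {disc_chart} disc_chart randers_metric z = randers z"
  using local_rep_disc[of z randers] by (simp add: randers_metric_def[abs_def])

lemma finsler_metric_randers: "finsler_metric 2 {disc_chart} randers_metric"
  unfolding finsler_metric_def
proof (intro conjI ballI allI impI)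
  fix q assume q: "q \<in> tangent_bundle 2 {disc_chart}"
  let ?z = "tangent_coords disc_chart q"
  have "(?z (Inl 0))\<^sup>2 + (?z (Inl 1))\<^sup>2 < 1/8"
    using q by (auto simp: tangent_bundle_disc tangent_coords_def disc_def)
  \<comment> \<open>The weak bound, because zero vectors are included here.\<close>
  from bform_bound(1)[OF this, of "?z (Inr 0)" "?z (Inr 1)"]
  have "\<bar>bform 0 ?z * ?z (Inr 0) + bform 1 ?z * ?z (Inr 1)\<bar> \<le> ylen ?z / 2"
    by (simp add: ylen_power2)
  moreover have "ylen ?z \<ge> 0" by (simp add: ylen_def)
  ultimately show "randers_metric q \<ge> 0"
    unfolding randers_metric_def randers_def by linarith
  fix a :: real assume a: "a > 0"
  have "ylen (tangent_coords disc_chart (scale_tangent a q)) = sqrt (a\<^sup>2 * ((?z (Inr 0))\<^sup>2 + (?z (Inr 1))\<^sup>2))"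
    by (simp add: ylen_def tangent_coords_def scale_tangent_def power_mult_distrib distrib_left)
  also have "\<dots> = a * ylen ?z"
    using a unfolding ylen_def real_sqrt_mult by simp
  finally show "randers_metric (scale_tangent a q) = a * randers_metric q"
    by (simp add: randers_metric_def randers_def bform_def tangent_coords_def scale_tangent_def algebra_simps)
next
  fix c assume "c \<in> {disc_chart}"
  then show "smooth_on_slit 2 {disc_chart} randers_metric c"
    unfolding smooth_on_slit_def
    by (auto intro: smooth_fun_on_cong[OF coord_open_disc_slit local_rep_randers_metric smooth_randers])
next
  fix c z and u :: "nat \<Rightarrow> real"
  assume "c \<in> {disc_chart}" "z \<in> slit_dom 2 c" "u \<in> coord_space {..<2}" "u \<noteq> (\<lambda>_. 0)"
  then show "(\<Sum>i<2. \<Sum>j<2. fund_tensor (local_rep 2 {disc_chart} c randers_metric) i j z * u i * u j) > 0"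
    using fund_tensor_pos[OF local_rep_randers_metric] by simp
qed

text \<open>Only the contraction with y matters: y^r / |y|^2 pairs with y to 1, so that
  \<open>Dtilde_covector\<close> pairs with y to minus the quotient of the two coefficients.\<close>

definition Dtilde_covector :: "nat \<Rightarrow> (nat + nat \<Rightarrow> real) \<Rightarrow> real" where
  "Dtilde_covector r z = (-1) * transport randers_connection Dtilde_coeff z * inverse (Dtilde_coeff z)
     * (z (Inr r) * inverse (ylen z) ^ 2)"

lemma smooth_Dtilde_covector: "smooth_disc (Dtilde_covector r)"
  unfolding Dtilde_covector_def[abs_def]
  by (intro smooth_disc_intros smooth_transport smooth_Dtilde_coeff smooth_inverse_ylen Dtilde_coeff_nonzero)

lemma Dtilde_covector_y:
  assumes "z \<in> disc_slit"
  shows "(\<Sum>r<2. Dtilde_covector r z * (Dtilde_coeff z * (z (Inr r) * c)))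
    = - (transport randers_connection Dtilde_coeff z * c)"
proof -
  have "(\<Sum>r<2. Dtilde_covector r z * (Dtilde_coeff z * (z (Inr r) * c)))
      = - transport randers_connection Dtilde_coeff z * c * (Dtilde_coeff z * inverse (Dtilde_coeff z))
        * (((z (Inr 0))\<^sup>2 + (z (Inr 1))\<^sup>2) * inverse (ylen z) ^ 2)"
    by (simp add: Dtilde_covector_def sum_lessThan_2 power2_eq_square algebra_simps)
  also have "((z (Inr 0))\<^sup>2 + (z (Inr 1))\<^sup>2) * inverse (ylen z) ^ 2 = 1"
    using ylen_pos[OF assms] by (simp add: ylen_power2[symmetric] power_inverse del: One_nat_def)
  finally show ?thesis
    using Dtilde_coeff_nonzero[OF assms] by simp
qed

lemma covector_field_Dtilde:
  "covector_field 2 {disc_chart} (\<lambda>q c r. Dtilde_covector r (tangent_coords disc_chart q))"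
  unfolding covector_field_def
proof (intro conjI ballI allI impI)
  fix q :: "(nat \<Rightarrow> real) tangent" and c c' r
  assume "c \<in> {disc_chart}" "c' \<in> {disc_chart}" "fst q \<in> chart_dom c \<and> fst q \<in> chart_dom c'" "r < (2::nat)"
  then show "Dtilde_covector r (tangent_coords disc_chart q) =
     (\<Sum>s<2. jacobian c c' (fst q) s r * Dtilde_covector s (tangent_coords disc_chart q))"
    by (auto simp: jacobian_disc sum_lessThan_2 less_2_cases_iff)
next
  fix c r assume "c \<in> {disc_chart}"
  then show "smooth_on_slit 2 {disc_chart} (\<lambda>q. Dtilde_covector r (tangent_coords disc_chart q)) c"
    unfolding smooth_on_slit_def
    by (auto intro: smooth_fun_on_cong[OF coord_open_disc_slit local_rep_disc[where g = "Dtilde_covector r"]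
          smooth_Dtilde_covector])
qed

lemma generalized_Dtilde_randers: "generalized_Dtilde_metric 2 {disc_chart} randers_metric"
  unfolding generalized_Dtilde_metric_def Let_def
proof (intro conjI exI[of _ "\<lambda>q c r. Dtilde_covector r (tangent_coords disc_chart q)"] ballI allI impI)
  fix c z and j i k l :: nat
  assume "c \<in> {disc_chart}" and z: "z \<in> slit_dom 2 c" and ijkl: "j < 2" "i < 2" "k < 2" "l < 2"
  then have c: "c = disc_chart" by simp
  note z = z[unfolded c]
  let ?L = "local_rep 2 {disc_chart} disc_chart randers_metric"
  \<comment> \<open>The upper index of D~ is carried by y^r, so the sum contracts the covector with
    y and leaves h_j h_k h_l.\<close>
  have "(\<Sum>r<2. local_rep 2 {disc_chart} disc_chart (\<lambda>q. Dtilde_covector r (tangent_coords disc_chart q)) z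
      * Dtilde 2 ?L j r k l z) = - (transport randers_connection Dtilde_coeff z * (rot j z * (rot k z * rot l z)))"
    unfolding Dtilde_covector_y[OF z, symmetric]
    by (intro sum.cong refl)
      (simp add: local_rep_disc[OF z] Dtilde_randers[OF local_rep_randers_metric] z ijkl)
  then show "hcov0 2 (local_rep 2 {disc_chart} c randers_metric)
       (Dtilde 2 (local_rep 2 {disc_chart} c randers_metric)) j i k l z +
      (\<Sum>r<2. local_rep 2 {disc_chart} c (\<lambda>q. Dtilde_covector r (tangent_coords disc_chart q)) z *
        Dtilde 2 (local_rep 2 {disc_chart} c randers_metric) j r k l z) * z (Inr i) = 0"
    using hcov0_Dtilde_randers[OF local_rep_randers_metric ijkl z] unfolding c by simp
qed (rule finsler_metric_randers, rule covector_field_Dtilde)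

lemma not_douglas_randers: "\<not> douglas_metric 2 {disc_chart} randers_metric"
proof
  assume D: "douglas_metric 2 {disc_chart} randers_metric"
  \<comment> \<open>At y = (1, 0) one has h = (0, 1), so the component with upper index 0 and all
    lower indices 1 equals d, which is nonzero.\<close>
  let ?y = "(\<lambda>_. 0)(0 := 1) :: nat \<Rightarrow> real"
  define z where "z = case_sum (\<lambda>_::nat. 0) ?y"
  have "?y 0 \<noteq> 0" by simp
  then have "?y \<noteq> (\<lambda>_. 0)" by metis
  then have z: "z \<in> disc_slit"
    unfolding slit_dom_def z_def by (force simp: disc_def coord_space_def)
  then have "douglas_tensor 2 (local_rep 2 {disc_chart} disc_chart randers_metric) 1 0 1 1 z = 0"
    using D by (simp add: douglas_metric_def)
  then have "douglas_coeff z * (z (Inr 0) * (rot 1 z * (rot 1 z * rot 1 z))) = 0"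
    by (subst (asm) douglas_tensor_randers[OF local_rep_randers_metric]) (use z in auto)
  then show False
    using ylen_pos[OF z] by (simp add: douglas_coeff_def z_def rot_def)
qed

theorem corollary4p8:
  shows "(\<forall>n (X :: 'm topology) A F.
            smooth_manifold n X A \<and> douglas_metric n A F \<longrightarrow> generalized_Dtilde_metric n A F) \<and>
         (\<exists>n (X :: (nat \<Rightarrow> real) topology) A F.
            smooth_manifold n X A \<and> generalized_Dtilde_metric n A F \<and> \<not> douglas_metric n A F)"
  using douglas_imp_generalized_Dtilde smooth_manifold_disc generalized_Dtilde_randers
    not_douglas_randers by blast

end
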